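(* Let $k\in\{1,2\}$ and let $G$ be a tight $(k,0)$-stable graph on $n$ vertices. Then the following hold. (a) If $k=1$ and $n$ is even, then $G$ contains a perfect matching. (b) If $k=1$ and $n$ is odd, then $G$ has a spanning subgraph that is a vertex-disjoint union of an odd cycle and a (possibly empty) matching. (c) If $k=2$ and $n$ is odd, then $G$ is an odd cycle. (d) If $k=2$ and $n$ is even, then $G$ has a spanning subgraph that is either a vertex-disjoint union of two odd cycles, or an even subdivision of $K_4$.
   Context: All graphs are finite and simple. For a graph $G=(V,E)$, $\alpha(G)$ denotes its independence number (the maximum size of an independent set of vertices), and for $v_1,\dots,v_k\in V$, $G\setminus\{v_1,\dots,v_k\}$ denotes the induced subgraph of $G$ on $V\setminus\{v_1,\dots,v_k\}$. For an integer $k\ge 1$, $G$ is called $(k,0)$-stable if for any $k$ vertices $v_1,\dots,v_k\in V$ we have $\alpha(G\setminus\{v_1,\dots,v_k\})\ge\alpha(G)$. A graph $G$ on $n$ vertices is called tight $(k,0)$-stable if it is $(k,0)$-stable and $\alpha(G)=\lfloor\frac{n-k+1}{2}\rfloor$. A spanning subgraph of $G$ is a subgraph (not necessarily induced) whose vertex set is all of $V$. An odd cycle is a cycle of odd length (at least $3$). A matching here, viewed as a graph, is a vertex-disjoint union of edges (with no isolated vertices). A graph $G'$ is an even subdivision of a graph $G$ if $G'$ can be obtained from $G$ by iteratively performing (zero or more times) the following operation on a graph $(V,E)$: take an edge $uv\in E$ and two new vertices $u',v'\notin V$, and replace $V$ by $V\cup\{u',v'\}$ and $E$ by $(E\setminus\{uv\})\cup\{uu',u'v',v'v\}$.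 $K_4$ is the complete graph on $4$ vertices. *)

theory Defs
  imports "HOL-Library.Ramsey"
begin

(* A graph is a vertex set together with a set of edges, each edge a two-element set of vertices. *)
type_synonym 'a graph = "'a set \<times> 'a set set"

abbreviation verts :: "'a graph \<Rightarrow> 'a set" where
  "verts \<equiv> fst"

abbreviation edges :: "'a graph \<Rightarrow> 'a set set" where
  "edges \<equiv> snd"

definition simple_graph :: "'a graph \<Rightarrow> bool" where
  "simple_graph G \<longleftrightarrow> finite (verts G) \<and> edges G \<subseteq> nsets (verts G) 2"

definition independent_set :: "'a graph \<Rightarrow> 'a set \<Rightarrow> bool" where
  "independent_set G S \<longleftrightarrow> S \<subseteq> verts G \<and> indep S (edges G)"

definition independence_number :: "'a graph \<Rightarrow> nat" where
  "independence_number G = Max (card ` {S. independent_set G S})"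

definition delete_verts :: "'a graph \<Rightarrow> 'a set \<Rightarrow> 'a graph" where
  "delete_verts G S = (verts G - S, {e \<in> edges G. e \<subseteq> verts G - S})"

(* (k,0)-stability; the k removed vertices are distinct. *)
definition stable :: "nat \<Rightarrow> 'a graph \<Rightarrow> bool" where
  "stable k G \<longleftrightarrow>
    (\<forall>S \<subseteq> verts G. card S = k \<longrightarrow> independence_number (delete_verts G S) \<ge> independence_number G)"

(* The floor is taken over the integers, where div rounds down; for n < k - 1 it is negative,
   so truncated subtraction on the naturals would give a different notion. *)
definition tight_stable :: "nat \<Rightarrow> 'a graph \<Rightarrow> bool" where
  "tight_stable k G \<longleftrightarrow>
    stable k G \<and> int (independence_number G) = (int (card (verts G)) - int k + 1) div 2"

definition spanning_subgraph :: "'a graph \<Rightarrow> 'a graph \<Rightarrow> bool" where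
  "spanning_subgraph H G \<longleftrightarrow> simple_graph H \<and> verts H = verts G \<and> edges H \<subseteq> edges G"

definition is_disjoint_union :: "'a graph \<Rightarrow> 'a graph \<Rightarrow> 'a graph \<Rightarrow> bool" where
  "is_disjoint_union H A B \<longleftrightarrow>
    verts A \<inter> verts B = {} \<and> H = (verts A \<union> verts B, edges A \<union> edges B)"

definition odd_cycle :: "'a graph \<Rightarrow> bool" where
  "odd_cycle G \<longleftrightarrow>
    (\<exists>vs. distinct vs \<and> length vs \<ge> 3 \<and> odd (length vs) \<and> verts G = set vs \<and>
      edges G = {{vs ! i, vs ! (Suc i mod length vs)} | i. i < length vs})"

definition matching :: "'a graph \<Rightarrow> bool" where
  "matching M \<longleftrightarrow>
    simple_graph M \<and> (\<forall>e \<in> edges M. \<forall>f \<in> edges M. e \<noteq> f \<longrightarrow> e \<inter> f = {}) \<and>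
    verts M = \<Union> (edges M)"

definition has_perfect_matching :: "'a graph \<Rightarrow> bool" where
  "has_perfect_matching G \<longleftrightarrow> (\<exists>M. spanning_subgraph M G \<and> matching M)"

definition is_K4 :: "'a graph \<Rightarrow> bool" where
  "is_K4 K \<longleftrightarrow> card (verts K) = 4 \<and> edges K = nsets (verts K) 2"

inductive even_subdivision :: "'a graph \<Rightarrow> 'a graph \<Rightarrow> bool" for G :: "'a graph" where
  refl: "even_subdivision G G"
| step: "even_subdivision G (V, E) \<Longrightarrow> {u, v} \<in> E \<Longrightarrow> u' \<notin> V \<Longrightarrow> v' \<notin> V \<Longrightarrow> u' \<noteq> v' \<Longrightarrow>
    even_subdivision G (V \<union> {u', v'}, (E - {{u, v}}) \<union> {{u, u'}, {u', v'}, {v', v}})"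

(* Subdividing only ever adds vertices, so a graph isomorphic to an even subdivision of the
   abstract K4 is itself obtained from a copy of K4 on four of its own vertices. *)
definition even_subdivision_of_K4 :: "'a graph \<Rightarrow> bool" where
  "even_subdivision_of_K4 H \<longleftrightarrow> (\<exists>K. is_K4 K \<and> even_subdivision K H)"

end

theory Submission
  imports Defs
begin

text \<open>
  The proof compares the number \<open>n\<close> of vertices with the independence number \<open>\<alpha>\<close> through the defect
  \<open>n - 2 \<alpha>\<close>. Tightness means that the defect is \<open>0\<close> or \<open>1\<close> for \<open>k = 1\<close> and \<open>1\<close> or \<open>2\<close> for \<open>k = 2\<close>,
  according to the parity of \<open>n\<close>.

  Stability enters as an expansion property: a tight \<open>(k,0)\<close>-stable graph satisfies
  \<open>|N(I)| \<ge> |I| + k - 1\<close> for all nonempty independent sets \<open>I\<close>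
  (\<open>expanding_of_avoiding_one\<close>, \<open>expanding_of_avoiding_two\<close>), because too small a
  neighbourhood could be swapped for \<open>I\<close> in a maximum independent set. Both stability and the
  defect pass to a spanning subgraph that is minimal with the same \<open>\<alpha>\<close>. In such a subgraph every
  edge is critical: deleting it produces an independent set of size \<open>\<alpha> + 1\<close> that contains both
  its ends. It therefore suffices to find the shape of critical graphs with expansion.

  Let a critical graph have \<open>|N(I)| \<ge> |I| + j\<close> for all nonempty independent \<open>I\<close>. If equality
  occurs at all, it occurs at a single vertex (\<open>slack_vertex\<close>), which then has degree \<open>j + 1\<close>.
  For \<open>j = 0\<close> that vertex and its neighbour form a component; splitting off all these edges
  leaves a matching and a critical graph that satisfies the inequality for \<open>j = 1\<close>
  (\<open>critical_matching_decomposition\<close>). For \<open>j = 1\<close> the vertex either lies in a triangle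
  component, whose removal lowers the defect by one, or can be contracted with its two neighbours,
  which keeps the defect. If equality never occurs for \<open>j = 1\<close>, a graph of defect at most two is
  empty or has defect two and is \<open>K\<^sub>4\<close>
  (\<open>two_expanding_is_K4\<close>). Hajnal's degree bound shows that undoing a contraction is always an
  even subdivision. By induction, a critical graph with \<open>|N(I)| \<ge> |I| + 1\<close> is empty for defect
  \<open>0\<close>, an odd cycle for defect \<open>1\<close>, and two odd cycles or an even subdivision of \<open>K\<^sub>4\<close> for
  defect \<open>2\<close> (\<open>critical_expanding_shape\<close>; the last case is essentially a theorem of Andrasfai).

  This gives a spanning subgraph of the required kind in all four cases. For \<open>k = 2\<close> and odd \<open>n\<close>
  the graph itself has to be the cycle: a chord would join two vertices of the unique maximum
  independent set of the cycle that avoids a suitable pair of vertices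
  (\<open>nonadjacent_pair_forced\<close>).
\<close>

section \<open>Neighbourhoods, expansion and critical graphs\<close>

definition nbrs :: "'a set set \<Rightarrow> 'a set \<Rightarrow> 'a set" where
  "nbrs E I = {y. \<exists>x\<in>I. {x, y} \<in> E}"

definition expanding :: "nat \<Rightarrow> 'a set \<Rightarrow> 'a set set \<Rightarrow> bool" where
  "expanding j V E \<longleftrightarrow>
    (\<forall>I\<subseteq>V. I \<noteq> {} \<longrightarrow> indep I E \<longrightarrow> card I + j \<le> card (nbrs E I))"

lemma nbrs_iff: "y \<in> nbrs E I \<longleftrightarrow> (\<exists>x\<in>I. {x, y} \<in> E)"
  by (simp add: nbrs_def)

lemma nbrs_singleton_iff: "y \<in> nbrs E {x} \<longleftrightarrow> {x, y} \<in> E"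
  by (simp add: nbrs_def)

lemma indep_subset: "indep S E \<Longrightarrow> T \<subseteq> S \<Longrightarrow> indep T E"
  by (auto simp: indep_def)

lemma indepD: "indep S E \<Longrightarrow> x \<in> S \<Longrightarrow> y \<in> S \<Longrightarrow> x \<noteq> y \<Longrightarrow> {x, y} \<notin> E"
  by (auto simp: indep_def)

lemma indep_fewer_edges: "indep S E \<Longrightarrow> F \<subseteq> E \<Longrightarrow> indep S F"
  by (auto simp: indep_def)

text \<open>
  Graphs that are critical for the independence number: \<open>a\<close> is the independence number,
  and deleting any single edge raises it. The set provided by the last axiom must contain both
  ends of the deleted edge, which is what makes critical graphs rigid: dropping one end leaves a
  maximum independent set through the other.
\<close>

locale critical_graph =
  fixes V :: "'a set" and E :: "'a set set" and a :: nat
  assumes finite_verts: "finite V"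
    and simple: "E \<subseteq> nsets V 2"
    and bound: "\<And>S. S \<subseteq> V \<Longrightarrow> indep S E \<Longrightarrow> card S \<le> a"
    and attained: "\<exists>S\<subseteq>V. indep S E \<and> card S = a"
    and critical: "\<And>e. e \<in> E \<Longrightarrow> \<exists>A\<subseteq>V. indep A (E - {e}) \<and> a < card A"
begin

lemma edge_in: "{x, y} \<in> E \<Longrightarrow> x \<in> V \<and> y \<in> V \<and> x \<noteq> y"
  using subsetD[OF simple, of "{x, y}"] by simp

lemma edge_cases:
  assumes "e \<in> E" obtains x y where "e = {x, y}" "x \<in> V" "y \<in> V" "x \<noteq> y"
  using assms simple by (meson nsets2_E subsetD)

lemma nbrs_subset: "nbrs E I \<subseteq> V"
  using edge_in by (auto simp: nbrs_def)

lemma finite_subset_verts: "S \<subseteq> V \<Longrightarrow> finite S"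
  using finite_verts finite_subset by blast

lemma finite_nbrs: "finite (nbrs E I)"
  using finite_subset_verts nbrs_subset by blast

lemma nbrs_indep_disjoint: "indep I E \<Longrightarrow> nbrs E I \<inter> I = {}"
  using edge_in by (auto simp: nbrs_def indep_def)

lemma witness:
  assumes "{p, q} \<in> E"
  obtains A where "A \<subseteq> V" "p \<in> A" "q \<in> A" "a < card A" "indep A (E - {{p, q}})"
proof -
  obtain A where A: "A \<subseteq> V" "indep A (E - {{p, q}})" "a < card A"
    using critical[OF assms] by blast
  have "p \<in> A \<and> q \<in> A"
  proof (rule ccontr)
    assume n: "\<not> (p \<in> A \<and> q \<in> A)"
    have "indep A E"
      using A(2) n unfolding indep_def by (metis Diff_iff doubleton_eq_iff singletonD)
    then show False using bound[of A] A by simp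
  qed
  then show thesis using that A by blast
qed

lemma witness_edge:
  assumes "indep A (E - {{p, q}})" "{x, y} \<in> E" "x \<in> A" "y \<in> A"
  shows "{x, y} = {p, q}"
  using assms edge_in unfolding indep_def by (metis Diff_iff singletonD)

text \<open>
  Trading \<open>p\<close> for \<open>v\<close> in a witness of the edge \<open>{p, c}\<close> destroys the only edge inside the
  witness. If \<open>p\<close> were the only neighbour of \<open>v\<close> in it, the result would be an independent set
  that is too large. This is the local rule behind everything said about vertices of degree one
  and two.
\<close>

lemma witness_swap:
  assumes A: "A \<subseteq> V" "indep A (E - {{p, c}})" "a < card A"
    and "p \<in> A" "{v, p} \<in> E" "{p, c} \<in> E" "v \<noteq> c"
  shows "\<exists>p'\<in>nbrs E {v} \<inter> A. p' \<noteq> p"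
proof (rule ccontr)
  assume no: "\<not> ?thesis"
  have "v \<in> V" "v \<noteq> p" using assms edge_in by auto
  have vA: "v \<notin> A"
    using witness_edge[OF A(2) assms(5)] assms edge_in by (metis doubleton_eq_iff)
  have "indep (insert v (A - {p})) E"
    unfolding indep_def
  proof (intro ballI impI)
    fix x y assume xy: "x \<in> insert v (A - {p})" "y \<in> insert v (A - {p})" "x \<noteq> y"
    show "{x, y} \<notin> E"
    proof
      assume e: "{x, y} \<in> E"
      consider "x = v" "y \<in> A - {p}" | "y = v" "x \<in> A - {p}" | "x \<in> A - {p}" "y \<in> A - {p}"
        using xy by blast
      then show False
      proof cases
        case 1 then show False using no e by (auto simp: nbrs_def)
      next
        case 2 then show False using no e by (auto simp: nbrs_def insert_commute)
      next
        case 3 then show False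
          using witness_edge[OF A(2) e] by (metis DiffE doubleton_eq_iff singletonI)
      qed
    qed
  qed
  moreover have "card (insert v (A - {p})) = card A"
    using vA \<open>p \<in> A\<close> finite_subset_verts[OF A(1)]
    by (simp add: card_Suc_Diff1 del: card_Diff_insert)
  ultimately show False
    using bound[of "insert v (A - {p})"] A \<open>v \<in> V\<close> by auto
qed

section \<open>Exact expansion at a single vertex\<close>

text \<open>
  Expansion that is exact somewhere is exact at a single vertex. Take a smallest independent
  set \<open>Q\<close> with too few neighbours. For an edge between \<open>p\<close> outside and \<open>q\<close> inside \<open>Q\<close> with
  witness \<open>A\<close>, exchanging \<open>A \<inter> N(Q)\<close> for \<open>Q\<close> shows that \<open>A \<inter> Q\<close> has too few neighbours as well,
  so \<open>Q \<subseteq> A\<close> by minimality. Hence \<open>q\<close> is the only neighbour of \<open>p\<close> in \<open>Q\<close>. The neighbourhoods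
  of the members of \<open>Q\<close> are therefore disjoint, and counting them leaves one of size \<open>j + 1\<close>.
\<close>

lemma slack_vertex:
  assumes exp: "expanding j V E" and not: "\<not> expanding (Suc j) V E"
  obtains v where "v \<in> V" "card (nbrs E {v}) = Suc j"
proof -
  define slack where "slack Q \<longleftrightarrow> Q \<subseteq> V \<and> Q \<noteq> {} \<and> indep Q E \<and> card (nbrs E Q) \<le> card Q + j" for Q
  have "\<exists>Q. slack Q" using not unfolding expanding_def slack_def by force
  then obtain Q where Q: "slack Q" and min: "\<And>R. slack R \<Longrightarrow> card Q \<le> card R"
    by (metis ex_has_least_nat)
  have QV: "Q \<subseteq> V" and Qne: "Q \<noteq> {}" and Qi: "indep Q E" and Qt: "card (nbrs E Q) \<le> card Q + j"
    using Q by (auto simp: slack_def)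
  have finQ: "finite Q" using finite_subset_verts QV by blast
  let ?P = "nbrs E Q"
  have PQ: "?P \<inter> Q = {}" by (rule nbrs_indep_disjoint[OF Qi])
  have unique: "q' = q" if "q \<in> Q" "q' \<in> Q" "{p, q} \<in> E" "{p, q'} \<in> E" for p q q'
  proof -
    obtain A where A: "A \<subseteq> V" "p \<in> A" "q \<in> A" "a < card A" "indep A (E - {{p, q}})"
      using witness \<open>{p, q} \<in> E\<close> by blast
    have finA: "finite A" using finite_subset_verts A by blast
    have pP: "p \<in> ?P" using that by (auto simp: nbrs_def insert_commute)
    define Q' where "Q' = A \<inter> Q"
    \<comment> \<open>The edge \<open>{p, q}\<close> is the only one inside \<open>A\<close>, and it leaves together with \<open>p\<close>.\<close>
    have "indep ((A - ?P) \<union> Q) E"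
      unfolding indep_def
    proof (intro ballI impI)
      fix x y assume xy: "x \<in> (A - ?P) \<union> Q" "y \<in> (A - ?P) \<union> Q" "x \<noteq> y"
      show "{x, y} \<notin> E"
      proof
        assume e: "{x, y} \<in> E"
        consider "x \<in> Q" | "y \<in> Q" | "x \<in> A - ?P" "y \<in> A - ?P" using xy by blast
        then show False
        proof cases
          case 1 then have "y \<in> ?P" using e by (auto simp: nbrs_def)
          then show False using xy PQ by blast
        next
          case 2 then have "x \<in> ?P" using e by (auto simp: nbrs_def insert_commute)
          then show False using xy PQ by blast
        next
          case 3 then show False
            using witness_edge[OF A(5) e] pP by (metis DiffE doubleton_eq_iff)
        qed
      qed
    qed
    then have "card ((A - ?P) \<union> Q) \<le> a"
      by (rule bound[rotated]) (use A QV in blast)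
    moreover have "card ((A - ?P) \<union> Q) + card Q' = card (A - ?P) + card Q"
    proof -
      have "(A - ?P) \<inter> Q = Q'" using PQ by (auto simp: Q'_def)
      then show ?thesis using card_Un_Int[of "A - ?P" Q] finA finQ by simp
    qed
    moreover have "card A = card (A \<inter> ?P) + card (A - ?P)"
      by (rule card_Int_Diff[OF finA])
    ultimately have c1: "card Q + 1 \<le> card (A \<inter> ?P) + card Q'" using A(4) by linarith
    have "nbrs E Q' \<subseteq> insert p (?P - A)"
    proof
      fix y assume "y \<in> nbrs E Q'"
      then obtain x where x: "x \<in> A" "x \<in> Q" "{x, y} \<in> E" by (auto simp: nbrs_def Q'_def)
      then have yP: "y \<in> ?P" by (auto simp: nbrs_def)
      show "y \<in> insert p (?P - A)"
      proof (cases "y \<in> A")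
        case True
        then have "{x, y} = {p, q}" using witness_edge[OF A(5)] x by blast
        then show ?thesis using yP PQ that by (metis IntI doubleton_eq_iff emptyE insertI1)
      qed (use yP in auto)
    qed
    then have "card (nbrs E Q') \<le> card (insert p (?P - A))"
      by (rule card_mono[rotated]) (simp add: finite_nbrs)
    also have "\<dots> \<le> card (?P - A) + 1" by (simp add: card_insert_if finite_nbrs)
    finally have "card (nbrs E Q') \<le> card (?P - A) + 1" .
    moreover have "card ?P = card (A \<inter> ?P) + card (?P - A)"
      using card_Int_Diff[OF finite_nbrs, of Q A] by (simp add: Int_commute)
    ultimately have "card (nbrs E Q') \<le> card Q' + j" using c1 Qt by linarith
    moreover have "q \<in> Q'" using A that by (simp add: Q'_def)
    moreover have "Q' \<subseteq> V" "indep Q' E" using QV indep_subset[OF Qi, of Q'] by (auto simp: Q'_def)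
    ultimately have "slack Q'" by (auto simp: slack_def)
    then have "card Q \<le> card Q'" by (rule min)
    then have "Q' = Q" using finQ by (simp add: Q'_def card_seteq)
    then have "q' \<in> A" using that Q'_def by blast
    then have "{p, q'} = {p, q}" using witness_edge[OF A(5)] that A by blast
    then show "q' = q" by (auto simp: doubleton_eq_iff)
  qed
  have "?P = (\<Union>q\<in>Q. nbrs E {q})" by (auto simp: nbrs_def)
  moreover have "card (\<Union>q\<in>Q. nbrs E {q}) = (\<Sum>q\<in>Q. card (nbrs E {q}))"
  proof (rule card_UN_disjoint)
    show "\<forall>q\<in>Q. \<forall>q'\<in>Q. q \<noteq> q' \<longrightarrow> nbrs E {q} \<inter> nbrs E {q'} = {}"
      using unique by (auto simp: nbrs_singleton_iff insert_commute)
  qed (use finQ finite_nbrs in auto)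
  ultimately have sum: "(\<Sum>q\<in>Q. card (nbrs E {q})) \<le> card Q + j" using Qt by simp
  \<comment> \<open>If all of them had \<open>j + 2\<close> neighbours, then \<open>|Q| (j + 2) \<le> |Q| + j\<close>, impossible for \<open>|Q| \<ge> 1\<close>.\<close>
  have "\<exists>q\<in>Q. card (nbrs E {q}) \<le> Suc j"
  proof (rule ccontr)
    assume "\<not> ?thesis"
    then have "\<And>q. q \<in> Q \<Longrightarrow> j + 2 \<le> card (nbrs E {q})" by force
    then have "card Q * (j + 2) \<le> (\<Sum>q\<in>Q. card (nbrs E {q}))"
      using sum_bounded_below[of Q "j + 2" "\<lambda>q. card (nbrs E {q})"] by simp
    moreover have "1 \<le> card Q" using Qne finQ by (simp add: Suc_leI card_gt_0_iff)
    then have "card Q + j < card Q * (j + 2)"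
      by (cases "card Q") auto
    ultimately show False using sum by linarith
  qed
  then obtain q where "q \<in> Q" "card (nbrs E {q}) \<le> Suc j" by blast
  moreover from this have "1 + j \<le> card (nbrs E {q})"
    using exp QV unfolding expanding_def by (auto simp: indep_def dest!: spec[of _ "{q}"])
  ultimately show thesis using that QV by force
qed

section \<open>Degrees in critical expanding graphs\<close>

text \<open>
  For a further set \<open>S\<close>, the set \<open>(S \<inter> \<Union>F) \<union> \<Inter>F\<close> is independent, because a vertex common to
  all members of \<open>F\<close> shares a member of \<open>F\<close> with each vertex of the union. Its size is
  therefore at most that of \<open>S\<close>, so adding \<open>S\<close> to \<open>F\<close> enlarges the union at least as much as it
  shrinks the intersection.
\<close>

lemma union_inter_of_maximum_independent_sets:
  assumes "finite F" "F \<noteq> {}"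
    and "\<And>S. S \<in> F \<Longrightarrow> S \<subseteq> V \<and> indep S E \<and> a \<le> card S"
  shows "2 * a \<le> card (\<Union>F) + card (\<Inter>F)"
  using assms
proof (induction rule: finite_ne_induct)
  case (singleton S)
  then show ?case by simp
next
  case (insert S F)
  define U where "U = \<Union>F"
  define I where "I = \<Inter>F"
  have F: "S' \<subseteq> V" "indep S' E" if "S' \<in> F" for S' using insert.prems that by auto
  have S: "S \<subseteq> V" "indep S E" "a \<le> card S" using insert.prems by auto
  have UV: "U \<subseteq> V" and IU: "I \<subseteq> U" using F insert.hyps by (auto simp: U_def I_def)
  have fin: "finite S" "finite U" "finite I"
    using S UV IU finite_subset_verts by auto
  have mixed: "{x, y} \<notin> E" if "x \<in> I" "y \<in> U" "x \<noteq> y" for x y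
  proof -
    obtain S' where "S' \<in> F" "y \<in> S'" using \<open>y \<in> U\<close> by (auto simp: U_def)
    moreover have "x \<in> S'" using that \<open>S' \<in> F\<close> by (auto simp: I_def)
    ultimately show ?thesis using indepD[OF F(2)] that by blast
  qed
  have "indep ((S \<inter> U) \<union> I) E"
    unfolding indep_def
  proof (intro ballI impI)
    fix x y assume xy: "x \<in> (S \<inter> U) \<union> I" "y \<in> (S \<inter> U) \<union> I" "x \<noteq> y"
    consider "x \<in> I" "y \<in> U" | "y \<in> I" "x \<in> U" | "x \<in> S" "y \<in> S" using xy IU by blast
    then show "{x, y} \<notin> E"
    proof cases
      case 1 then show ?thesis using mixed xy by blast
    next
      case 2 then show ?thesis using mixed[of y x] xy by (simp add: insert_commute)
    next
      case 3 then show ?thesis using indepD[OF S(2)] xy by blast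
    qed
  qed
  then have "card ((S \<inter> U) \<union> I) \<le> a" by (rule bound[rotated]) (use S UV IU in blast)
  moreover have "card (S \<inter> U) + card I = card ((S \<inter> U) \<union> I) + card (S \<inter> I)"
    using card_Un_Int[of "S \<inter> U" I] fin IU by (simp add: Int_assoc Int_absorb1)
  moreover have "card S + card U = card (S \<union> U) + card (S \<inter> U)"
    using card_Un_Int fin by blast
  moreover have "2 * a \<le> card U + card I"
    using insert.IH insert.prems by (simp add: U_def I_def)
  ultimately have "2 * a \<le> card (S \<union> U) + card (S \<inter> I)" using S by linarith
  then show ?case by (simp add: U_def I_def)
qed

text \<open>
  Hajnal's degree bound. Each edge \<open>{u, v}\<close> has a witness, and dropping \<open>v\<close> from it gives a
  maximum independent set \<open>R v\<close> through \<open>u\<close>. The union of these sets misses all of \<open>N(u)\<close>. It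
  also misses the neighbours of \<open>J\<close>, the common part without \<open>u\<close>: since \<open>u \<notin> J\<close>, no vertex of \<open>J\<close>
  is adjacent to any vertex of a witness, and hence none to a \<open>v \<in> N(u)\<close>. As the union and
  the intersection of the \<open>R v\<close> together have at least \<open>2 a\<close> elements, expansion of \<open>J\<close> leaves
  little room for \<open>N(u)\<close>.
\<close>

lemma degree_bound:
  assumes exp: "expanding 1 V E" and n: "card V \<le> 2 * a + d" and "u \<in> V"
  shows "card (nbrs E {u}) \<le> d + 1"
proof (cases "nbrs E {u} = {}")
  case False
  let ?N = "nbrs E {u}"
  have "\<forall>v\<in>?N. \<exists>A. A \<subseteq> V \<and> u \<in> A \<and> v \<in> A \<and> a < card A \<and> indep A (E - {{u, v}})"
  proof
    fix v assume "v \<in> ?N"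
    then have "{u, v} \<in> E" by (simp add: nbrs_singleton_iff)
    then show "\<exists>A. A \<subseteq> V \<and> u \<in> A \<and> v \<in> A \<and> a < card A \<and> indep A (E - {{u, v}})"
      using witness by metis
  qed
  then obtain A where A: "\<And>v. v \<in> ?N \<Longrightarrow> A v \<subseteq> V \<and> u \<in> A v \<and> v \<in> A v \<and> a < card (A v)
      \<and> indep (A v) (E - {{u, v}})"
    by metis
  have u_edge: "{u, v} \<in> E" "v \<noteq> u" if "v \<in> ?N" for v
    using that edge_in[of u v] by (auto simp: nbrs_singleton_iff)
  have inside: "{x, y} = {u, v}" if "v \<in> ?N" "{x, y} \<in> E" "x \<in> A v" "y \<in> A v" for v x y
    using witness_edge[of "A v" u v x y] A[OF that(1)] that by blast
  define R where "R v = A v - {v}" for v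
  have indR: "indep (R v) E" if "v \<in> ?N" for v
    unfolding indep_def
  proof (intro ballI impI notI)
    fix x y assume "x \<in> R v" "y \<in> R v" "{x, y} \<in> E"
    then show False using inside[OF that, of x y] by (auto simp: R_def doubleton_eq_iff)
  qed
  have cardR: "a \<le> card (R v)" if "v \<in> ?N" for v
    using A[OF that] finite_subset_verts[of "A v"] by (auto simp: R_def)
  define F where "F = R ` ?N"
  have finF: "finite F" "F \<noteq> {}" using False finite_nbrs by (auto simp: F_def)
  have RV: "R v \<subseteq> V" if "v \<in> ?N" for v using A[OF that] by (auto simp: R_def)
  have large: "2 * a \<le> card (\<Union>F) + card (\<Inter>F)"
    using union_inter_of_maximum_independent_sets[OF finF] RV indR cardR by (auto simp: F_def)
  have UV: "\<Union>F \<subseteq> V" using RV by (auto simp: F_def)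
  have UN: "\<Union>F \<inter> ?N = {}"
  proof -
    have False if "v \<in> ?N" "w \<in> ?N" "w \<in> R v" for v w
      using inside[OF that(1), of u w] u_edge[OF that(2)] A[OF that(1)] that(3)
      by (auto simp: R_def doubleton_eq_iff)
    then show ?thesis by (auto simp: F_def)
  qed
  have "card (\<Union>F \<union> ?N) = card (\<Union>F) + card ?N"
    using UN UV finite_nbrs finite_subset_verts by (simp add: card_Un_disjoint)
  moreover have "card (\<Union>F \<union> ?N) \<le> card V"
    using UV nbrs_subset finite_verts by (simp add: card_mono)
  ultimately have UN_card: "card (\<Union>F) + card ?N \<le> card V" by simp
  define J where "J = \<Inter>F - {u}"
  have uR: "u \<in> R v" if "v \<in> ?N" for v using A[OF that] u_edge[OF that] by (auto simp: R_def)
  have u_in: "u \<in> \<Inter>F" using uR by (auto simp: F_def)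
  obtain v0 where v0: "v0 \<in> ?N" using False by blast
  have interV: "\<Inter>F \<subseteq> R v0" using v0 by (auto simp: F_def)
  have finI: "finite (\<Inter>F)" using interV RV[OF v0] finite_subset_verts by (meson subset_trans)
  have cardJ: "card (\<Inter>F) = Suc (card J)"
    unfolding J_def using card.remove[OF finI u_in] by simp
  show ?thesis
  proof (cases "J = {}")
    case True
    then show ?thesis using large cardJ UN_card n by simp
  next
    case False
    have JR: "J \<subseteq> R v" if "v \<in> ?N" for v using that by (auto simp: J_def F_def)
    have "indep J E" using indR[OF v0] JR[OF v0] by (rule indep_subset)
    moreover have "J \<subseteq> V" using JR[OF v0] RV[OF v0] by blast
    ultimately have "card J + 1 \<le> card (nbrs E J)"
      using exp False by (auto simp: expanding_def)
    moreover have "card (nbrs E J \<union> (\<Union>F \<union> ?N)) = card (nbrs E J) + card (\<Union>F \<union> ?N)"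
    proof (rule card_Un_disjoint)
      have no_R: False if "v \<in> ?N" "x \<in> J" "{x, y} \<in> E" "y \<in> R v" for v x y
        using indepD[OF indR[OF that(1)], of x y] JR[OF that(1)] that edge_in[OF that(3)] by blast
      have no_N: False if "y \<in> ?N" "x \<in> J" "{x, y} \<in> E" for x y
        using inside[OF that(1), of x y] JR[OF that(1)] that A[OF that(1)]
        by (auto simp: doubleton_eq_iff R_def J_def)
      show "nbrs E J \<inter> (\<Union>F \<union> ?N) = {}"
        using no_R no_N unfolding F_def nbrs_iff[of _ _ J] disjoint_iff by blast
    qed (use finite_nbrs UV finite_subset_verts in auto)
    moreover have "card (nbrs E J \<union> (\<Union>F \<union> ?N)) \<le> card V"
      using UV nbrs_subset finite_verts by (simp add: card_mono)
    ultimately show ?thesis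
      using large cardJ n \<open>card (\<Union>F \<union> ?N) = card (\<Union>F) + card ?N\<close> by linarith
  qed
qed simp

text \<open>
  Away from \<open>u\<close>, the common part of the two witnesses has no neighbour in either of them, so its
  neighbourhood fits into the complement of their union; that complement is too small for the
  assumed expansion.
\<close>

lemma witnesses_meet_once:
  assumes exp: "expanding d V E" and n: "card V \<le> 2 * a + d"
    and "{u, v} \<in> E" "{u, w} \<in> E" "v \<noteq> w"
    and A: "A \<subseteq> V" "u \<in> A" "v \<in> A" "a < card A" "indep A (E - {{u, v}})"
    and B: "B \<subseteq> V" "u \<in> B" "w \<in> B" "a < card B" "indep B (E - {{u, w}})"
  shows "A \<inter> B = {u}"
proof (rule ccontr)
  assume "A \<inter> B \<noteq> {u}"
  define J where "J = A \<inter> B - {u}"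
  have "J \<noteq> {}" using \<open>A \<inter> B \<noteq> {u}\<close> A B by (auto simp: J_def)
  have JV: "J \<subseteq> V" using A by (auto simp: J_def)
  have no_A: False if "x \<in> J" "{x, y} \<in> E" "y \<in> A" for x y
  proof -
    have "{x, y} = {u, v}" using witness_edge[OF A(5) that(2)] that by (auto simp: J_def)
    then have "v \<in> B" using that by (auto simp: J_def doubleton_eq_iff)
    then have "{u, v} = {u, w}" using witness_edge[OF B(5), of u v] assms by blast
    then show False using \<open>v \<noteq> w\<close> by (auto simp: doubleton_eq_iff)
  qed
  have no_B: False if "x \<in> J" "{x, y} \<in> E" "y \<in> B" for x y
  proof -
    have "{x, y} = {u, w}" using witness_edge[OF B(5) that(2)] that by (auto simp: J_def)
    then have "w \<in> A" using that by (auto simp: J_def doubleton_eq_iff)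
    then have "{u, w} = {u, v}" using witness_edge[OF A(5), of u w] assms by blast
    then show False using \<open>v \<noteq> w\<close> by (auto simp: doubleton_eq_iff)
  qed
  have "indep J E" using no_A unfolding indep_def J_def by blast
  then have "card J + d \<le> card (nbrs E J)"
    using exp \<open>J \<noteq> {}\<close> JV by (auto simp: expanding_def)
  moreover have "card (nbrs E J \<union> (A \<union> B)) = card (nbrs E J) + card (A \<union> B)"
  proof (rule card_Un_disjoint)
    show "nbrs E J \<inter> (A \<union> B) = {}"
      using no_A no_B unfolding nbrs_iff disjoint_iff by blast
  qed (use finite_nbrs A B finite_subset_verts in auto)
  moreover have "card (nbrs E J \<union> (A \<union> B)) \<le> card V"
    using A B nbrs_subset finite_verts by (simp add: card_mono)
  moreover have "card A + card B = card (A \<union> B) + card (A \<inter> B)"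
    using card_Un_Int[OF finite_subset_verts[OF A(1)] finite_subset_verts[OF B(1)]] .
  moreover have "card (A \<inter> B) = Suc (card J)"
    unfolding J_def using card.remove[of "A \<inter> B" u] A B finite_subset_verts[of A] by simp
  ultimately show False using A(4) B(4) n by linarith
qed

text \<open>
  A vertex \<open>u\<close> has three neighbours, whose three witnesses pairwise meet only in \<open>u\<close>. Three sets
  of more than \<open>a\<close> vertices fit in this way into \<open>2 a + 2\<close> vertices only if \<open>a \<le> 1\<close>. Then there
  are exactly four vertices, and any two of them are adjacent.
\<close>

lemma two_expanding_is_K4:
  assumes exp: "expanding 2 V E" and n: "card V \<le> 2 * a + 2" and "V \<noteq> {}"
  shows "is_K4 (V, E)"
proof -
  obtain u where u: "u \<in> V" using \<open>V \<noteq> {}\<close> by blast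
  have "card {u} + 2 \<le> card (nbrs E {u})"
    using exp u by (auto simp: expanding_def indep_def dest!: spec[of _ "{u}"])
  then have deg: "3 \<le> card (nbrs E {u})" by simp
  then obtain T where "T \<subseteq> nbrs E {u}" "card T = 3"
    using obtain_subset_with_card_n by metis
  then obtain v1 v2 v3 where e: "{u, v1} \<in> E" "{u, v2} \<in> E" "{u, v3} \<in> E"
    and ne: "v1 \<noteq> v2" "v1 \<noteq> v3" "v2 \<noteq> v3"
    by (auto simp: card_3_iff nbrs_singleton_iff)
  obtain A1 where A1: "A1 \<subseteq> V" "u \<in> A1" "v1 \<in> A1" "a < card A1" "indep A1 (E - {{u, v1}})"
    using witness[OF e(1)] by blast
  obtain A2 where A2: "A2 \<subseteq> V" "u \<in> A2" "v2 \<in> A2" "a < card A2" "indep A2 (E - {{u, v2}})"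
    using witness[OF e(2)] by blast
  obtain A3 where A3: "A3 \<subseteq> V" "u \<in> A3" "v3 \<in> A3" "a < card A3" "indep A3 (E - {{u, v3}})"
    using witness[OF e(3)] by blast
  have i12: "A1 \<inter> A2 = {u}" using witnesses_meet_once[OF exp n e(1,2) ne(1) A1 A2] .
  have i13: "A1 \<inter> A3 = {u}" using witnesses_meet_once[OF exp n e(1,3) ne(2) A1 A3] .
  have i23: "A2 \<inter> A3 = {u}" using witnesses_meet_once[OF exp n e(2,3) ne(3) A2 A3] .
  have fin: "finite A1" "finite A2" "finite A3" using A1 A2 A3 finite_subset_verts by auto
  have "card A1 + card A2 = card (A1 \<union> A2) + 1" using card_Un_Int[OF fin(1,2)] i12 by simp
  moreover have "card (A1 \<union> A2) + card A3 = card (A1 \<union> A2 \<union> A3) + 1"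
  proof -
    have "(A1 \<union> A2) \<inter> A3 = {u}" using i13 i23 by blast
    then show ?thesis using card_Un_Int[of "A1 \<union> A2" A3] fin by simp
  qed
  moreover have "card (A1 \<union> A2 \<union> A3) \<le> card V"
    using A1 A2 A3 finite_verts by (simp add: card_mono)
  ultimately have a1: "a \<le> 1" using n A1(4) A2(4) A3(4) by linarith
  have "card (insert u (nbrs E {u})) \<le> card V"
    using u nbrs_subset finite_verts by (simp add: card_mono)
  moreover have "u \<notin> nbrs E {u}" using edge_in[of u u] by (auto simp: nbrs_singleton_iff)
  ultimately have "4 \<le> card V" using deg finite_nbrs by simp
  then have "card V = 4" using n a1 by linarith
  moreover have "nsets V 2 \<subseteq> E"
  proof
    fix e assume "e \<in> nsets V 2"
    then obtain x y where xy: "e = {x, y}" "x \<in> V" "y \<in> V" "x \<noteq> y" by (rule nsets2_E)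
    show "e \<in> E"
    proof (rule ccontr)
      assume "e \<notin> E"
      then have "indep {x, y} E" using xy by (auto simp: indep_def insert_commute)
      then have "card {x, y} \<le> a" using bound[of "{x, y}"] xy by simp
      then show False using xy a1 by simp
    qed
  qed
  ultimately show ?thesis using simple by (auto simp: is_K4_def)
qed

section \<open>Removing a clique component\<close>

context
  fixes X :: "'a set"
  assumes clique_in: "X \<subseteq> V"
    and clique_ne: "X \<noteq> {}"
    and clique: "\<And>x y. x \<in> X \<Longrightarrow> y \<in> X \<Longrightarrow> x \<noteq> y \<Longrightarrow> {x, y} \<in> E"
    and closed: "\<And>x y. x \<in> X \<Longrightarrow> {x, y} \<in> E \<Longrightarrow> y \<in> X"
begin

lemma clique_component_edges: "E = {e \<in> E. e \<subseteq> V - X} \<union> nsets X 2"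
proof (intro equalityI subsetI)
  fix e assume e: "e \<in> E"
  then obtain x y where xy: "e = {x, y}" "x \<in> V" "y \<in> V" "x \<noteq> y" by (rule edge_cases)
  then show "e \<in> {e \<in> E. e \<subseteq> V - X} \<union> nsets X 2"
    using closed[of x y] closed[of y x] e by (auto simp: insert_commute)
next
  fix e assume "e \<in> {e \<in> E. e \<subseteq> V - X} \<union> nsets X 2"
  then show "e \<in> E" using clique by (auto elim!: nsets2_E)
qed

text \<open>
  A clique component contributes exactly one vertex to every maximum independent set and at
  most one to the witness of an edge elsewhere.
\<close>

lemma clique_component_removal:
  "1 \<le> a" "critical_graph (V - X) {e \<in> E. e \<subseteq> V - X} (a - 1)"
proof -
  obtain x where x: "x \<in> X" using clique_ne by blast
  have add: "card S + 1 \<le> a" if S: "S \<subseteq> V - X" "indep S {e \<in> E. e \<subseteq> V - X}" for S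
  proof -
    have "indep (insert x S) E"
      unfolding indep_def
    proof (intro ballI impI notI)
      fix y z assume yz: "y \<in> insert x S" "z \<in> insert x S" "y \<noteq> z" "{y, z} \<in> E"
      have "y \<noteq> x \<and> z \<noteq> x"
        using closed[of x y] closed[of x z] yz x S by (auto simp: insert_commute)
      then show False using yz S by (auto simp: indep_def)
    qed
    then have "card (insert x S) \<le> a" by (rule bound[rotated]) (use x S clique_in in auto)
    moreover have "finite S" using S finite_subset_verts by blast
    moreover have "x \<notin> S" using x S by blast
    ultimately show ?thesis by simp
  qed
  have drop: "card A \<le> card (A - X) + 1"
    if A: "A \<subseteq> V" "\<And>y z. y \<in> A \<inter> X \<Longrightarrow> z \<in> A \<inter> X \<Longrightarrow> y = z" for A
  proof -
    have "card (A \<inter> X) \<le> 1"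
      using A(2) card_le_Suc0_iff_eq[of "A \<inter> X"] finite_subset_verts[OF A(1)] by auto
    then show ?thesis using card_Int_Diff[OF finite_subset_verts[OF A(1)], of X] by linarith
  qed
  show "1 \<le> a" using add[of "{}"] by (simp add: indep_def)
  show "critical_graph (V - X) {e \<in> E. e \<subseteq> V - X} (a - 1)"
  proof
    show "finite (V - X)" using finite_verts by simp
    show "{e \<in> E. e \<subseteq> V - X} \<subseteq> nsets (V - X) 2"
      using simple by (auto simp: nsets_def)
    show "card S \<le> a - 1" if "S \<subseteq> V - X" "indep S {e \<in> E. e \<subseteq> V - X}" for S
      using add[OF that] by simp
    show "\<exists>S\<subseteq>V - X. indep S {e \<in> E. e \<subseteq> V - X} \<and> card S = a - 1"
    proof -
      obtain S where S: "S \<subseteq> V" "indep S E" "card S = a" using attained by blast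
      have SX: "indep (S - X) {e \<in> E. e \<subseteq> V - X}" "S - X \<subseteq> V - X"
        using S by (auto simp: indep_def)
      moreover have "card S \<le> card (S - X) + 1"
        by (rule drop[OF S(1)]) (use clique S(2) in \<open>auto simp: indep_def\<close>)
      ultimately show ?thesis using add[OF SX(2,1)] S(3) by (intro exI[of _ "S - X"]) auto
    qed
    show "\<exists>A\<subseteq>V - X. indep A ({e \<in> E. e \<subseteq> V - X} - {e}) \<and> a - 1 < card A"
      if "e \<in> {e \<in> E. e \<subseteq> V - X}" for e
    proof -
      have e: "e \<in> E" "e \<inter> X = {}" using that by auto
      obtain A where A: "A \<subseteq> V" "indep A (E - {e})" "a < card A" using critical[OF e(1)] by blast
      have "card A \<le> card (A - X) + 1"
      proof (rule drop[OF A(1)], rule ccontr)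
        fix y z assume "y \<in> A \<inter> X" "z \<in> A \<inter> X" "y \<noteq> z"
        then have "{y, z} \<in> E - {e}" "y \<in> A" "z \<in> A" using clique[of y z] e(2) by auto
        then show False using A(2) \<open>y \<noteq> z\<close> by (auto simp: indep_def)
      qed
      moreover have "indep (A - X) ({e \<in> E. e \<subseteq> V - X} - {e})"
        using A(2) by (auto simp: indep_def)
      ultimately show ?thesis using A \<open>1 \<le> a\<close> by (intro exI[of _ "A - X"]) auto
    qed
  qed
qed

lemma clique_component_expanding:
  assumes "expanding j V E"
  shows "expanding j (V - X) {e \<in> E. e \<subseteq> V - X}"
  unfolding expanding_def
proof (intro allI impI)
  fix I assume I: "I \<subseteq> V - X" "I \<noteq> {}" "indep I {e \<in> E. e \<subseteq> V - X}"
  have "indep I E" using I by (auto simp: indep_def)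
  then have "card I + j \<le> card (nbrs E I)"
    using assms I unfolding expanding_def by blast
  also have "nbrs E I \<subseteq> nbrs {e \<in> E. e \<subseteq> V - X} I"
  proof
    fix z assume "z \<in> nbrs E I"
    then obtain i where i: "i \<in> I" "{i, z} \<in> E" by (auto simp: nbrs_iff)
    then have "z \<notin> X" using closed[of z i] I by (auto simp: insert_commute)
    then show "z \<in> nbrs {e \<in> E. e \<subseteq> V - X} I"
      using i I edge_in[OF i(2)] by (auto simp: nbrs_iff)
  qed
  then have "card (nbrs E I) \<le> card (nbrs {e \<in> E. e \<subseteq> V - X} I)"
    by (rule card_mono[rotated])
      (rule finite_subset[OF _ finite_nbrs[of I]], auto simp: nbrs_iff)
  finally show "card I + j \<le> card (nbrs {e \<in> E. e \<subseteq> V - X} I)" .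
qed

end

section \<open>Contracting a vertex of degree two\<close>

text \<open>
  If the two neighbours \<open>x\<close> and \<open>y\<close> of \<open>v\<close> are not adjacent, the path \<open>x v y\<close> can be contracted
  to a single vertex, for which the name \<open>x\<close> is kept. The independence number drops by one,
  the number of vertices by two. Independent sets are translated back by adding \<open>y\<close> if they
  contain \<open>x\<close>, and \<open>v\<close> otherwise.
\<close>

context
  fixes v x y :: 'a
  assumes v_nbrs: "nbrs E {v} = {x, y}"
    and x_ne_y: "x \<noteq> y"
    and nonadjacent: "{x, y} \<notin> E"
begin

lemma v_edges: "{v, x} \<in> E" "{v, y} \<in> E" "{v, z} \<in> E \<Longrightarrow> z = x \<or> z = y"
  using v_nbrs by (auto simp: nbrs_def)

lemma path_verts: "v \<in> V" "x \<in> V" "y \<in> V" "v \<noteq> x" "v \<noteq> y"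
  using v_edges edge_in by blast+

lemma witness_contains_both:
  assumes "A \<subseteq> V" "indep A (E - {{x, z}})" "a < card A" "x \<in> A" "{x, z} \<in> E" "z \<noteq> v"
  shows "y \<in> A"
  using witness_swap[OF assms(1,2,3,4) v_edges(1) assms(5)] assms(6) v_nbrs by auto

text \<open>
  A witness of \<open>{x, z}\<close> contains \<open>y\<close>, hence cannot contain a neighbour \<open>z\<close> of \<open>y\<close>. This keeps the
  contraction from merging two edges into one.
\<close>

lemma no_other_common_nbr: "{x, z} \<in> E \<Longrightarrow> {y, z} \<in> E \<Longrightarrow> z = v"
proof (rule ccontr)
  assume e: "{x, z} \<in> E" "{y, z} \<in> E" "z \<noteq> v"
  obtain A where A: "A \<subseteq> V" "x \<in> A" "z \<in> A" "a < card A" "indep A (E - {{x, z}})"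
    using witness[OF e(1)] by blast
  have "y \<in> A" using witness_contains_both[OF A(1,5,4,2) e(1,3)] .
  then have "{y, z} = {x, z}" using witness_edge[OF A(5) e(2)] A by blast
  then show False using x_ne_y by (auto simp: doubleton_eq_iff)
qed

definition contracted_edges :: "'a set set" where
  "contracted_edges = {e \<in> E. e \<subseteq> V - {v, y}} \<union> {{x, z} | z. {y, z} \<in> E \<and> z \<noteq> v}"

lemma contracted_edge_iff:
  "{p, q} \<in> contracted_edges \<longleftrightarrow>
    {p, q} \<in> E \<and> p \<notin> {v, y} \<and> q \<notin> {v, y} \<or>
    p = x \<and> {y, q} \<in> E \<and> q \<noteq> v \<or> q = x \<and> {y, p} \<in> E \<and> p \<noteq> v"
  using edge_in[of p q] unfolding contracted_edges_def by (auto simp: doubleton_eq_iff)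

lemma contracted_x_nbrs:
  "nbrs contracted_edges {x} = (nbrs E {x} - {v}) \<union> (nbrs E {y} - {v})"
  using nonadjacent edge_in[of x x] edge_in[of y y] path_verts
  by (auto simp: nbrs_singleton_iff contracted_edge_iff insert_commute)

text \<open>
  For \<open>z\<close> in a set that contains \<open>y\<close>, a new edge \<open>{x, z}\<close> comes from an edge \<open>{y, z}\<close> inside the
  set. The two conditions on \<open>e\<close> and \<open>e'\<close> say that the one edge tolerated before corresponds to
  the one tolerated afterwards.
\<close>

lemma contraction_of_two_nbrs:
  assumes "indep A (E - {e})" "v \<notin> A" "y \<in> A"
    and "\<And>z. {y, z} \<in> E \<Longrightarrow> z \<in> A \<Longrightarrow> {y, z} = e \<Longrightarrow> {x, z} = e'"
    and "e \<in> contracted_edges \<Longrightarrow> e = e'"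
  shows "indep (A - {y}) (contracted_edges - {e'})"
  unfolding indep_def
proof (intro ballI impI notI)
  fix p q assume pq: "p \<in> A - {y}" "q \<in> A - {y}" "p \<noteq> q" "{p, q} \<in> contracted_edges - {e'}"
  have *: False if "z \<in> A - {y}" "{y, z} \<in> E" "{x, z} \<noteq> e'" for z
  proof -
    have "{y, z} = e" using assms(1,3) that by (auto simp: indep_def)
    then show False using assms(4) that by blast
  qed
  have "{p, q} \<in> contracted_edges" "{p, q} \<noteq> e'" using pq by auto
  then consider "{p, q} \<in> E" | "p = x" "{y, q} \<in> E" | "q = x" "{y, p} \<in> E"
    unfolding contracted_edge_iff by blast
  then show False
  proof cases
    case 1
    then have "{p, q} = e" using assms(1) pq by (auto simp: indep_def)
    then show False using assms(5) pq by blast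
  next
    case 2
    then show False using *[of q] pq by auto
  next
    case 3
    then show False using *[of p] pq by (auto simp: insert_commute)
  qed
qed

text \<open>
  A set independent up to one edge is carried to the contracted graph by removing one vertex: \<open>y\<close>
  if it contains both \<open>x\<close> and \<open>y\<close>, and otherwise the at most one vertex that it has on the path
  \<open>x v y\<close>. For an edge at \<open>x\<close>, old or new, \<open>witness_swap\<close> forces the witness to contain both
  \<open>x\<close> and \<open>y\<close>, so the contracted \<open>x\<close> survives.
\<close>

lemma contraction_critical: "1 \<le> a" "critical_graph (V - {v, y}) contracted_edges (a - 1)"
proof -
  let ?V = "V - {v, y}"
  have grow: "card S + 1 \<le> a" if S: "S \<subseteq> ?V" "indep S contracted_edges" for S
  proof -
    define w where "w = (if x \<in> S then y else v)"
    have w: "w \<in> V" "w \<notin> S" using S path_verts by (auto simp: w_def)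
    have free: "{w, z} \<notin> E" if "z \<in> S" for z
    proof
      assume e: "{w, z} \<in> E"
      show False
      proof (cases "x \<in> S")
        case True
        then have "{x, z} \<in> contracted_edges" "x \<noteq> z"
          using e that S nonadjacent by (auto simp: w_def contracted_edge_iff insert_commute)
        then show False using S(2) True that by (auto simp: indep_def)
      next
        case False
        then show False using e v_edges(3)[of z] that S by (auto simp: w_def)
      qed
    qed
    have "indep (insert w S) E"
      unfolding indep_def
    proof (intro ballI impI notI)
      fix p q assume pq: "p \<in> insert w S" "q \<in> insert w S" "p \<noteq> q" "{p, q} \<in> E"
      then have "p \<in> S" "q \<in> S" using free[of p] free[of q] by (auto simp: insert_commute)
      then show False using pq S by (auto simp: indep_def contracted_edge_iff)
    qed
    then have "card (insert w S) \<le> a" by (rule bound[rotated]) (use w S in auto)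
    moreover have "finite S" using S finite_subset_verts by blast
    ultimately show ?thesis using w by simp
  qed
  show a1: "1 \<le> a" using grow[of "{}"] by (simp add: indep_def)
  have drop_one: "card A \<le> card (A - {y}) + 1" for A
    by (auto simp: card_Diff_singleton_if)
  have drop_path: "card A \<le> card (A - {v, x, y}) + 1"
    if A: "A \<subseteq> V" "\<not> (x \<in> A \<and> y \<in> A)" "\<not> (v \<in> A \<and> x \<in> A)" "\<not> (v \<in> A \<and> y \<in> A)" for A
  proof -
    have "card (A \<inter> {v, x, y}) \<le> 1"
      using A by (intro card_le_Suc0_iff_eq[THEN iffD2, THEN order_trans]) auto
    then show ?thesis using card_Int_Diff[OF finite_subset_verts[OF A(1)], of "{v, x, y}"] by linarith
  qed
  have off_x: "indep (A - {v, x, y}) (contracted_edges - {e})" if "indep A (E - {e})" for A e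
    using that by (auto simp: indep_def contracted_edge_iff)
  show "critical_graph ?V contracted_edges (a - 1)"
  proof
    show "finite ?V" using finite_verts by simp
    show "contracted_edges \<subseteq> nsets ?V 2"
    proof
      fix e assume "e \<in> contracted_edges"
      then consider "e \<in> E" "e \<subseteq> ?V" | z where "e = {x, z}" "{y, z} \<in> E" "z \<noteq> v"
        unfolding contracted_edges_def by blast
      then show "e \<in> nsets ?V 2"
      proof cases
        case 1
        then show ?thesis using simple by (auto simp: nsets_def)
      next
        case 2
        then have "z \<noteq> x" using nonadjacent by (auto simp: insert_commute)
        then show ?thesis using 2 edge_in[OF 2(2)] path_verts x_ne_y by auto
      qed
    qed
    show "card S \<le> a - 1" if "S \<subseteq> ?V" "indep S contracted_edges" for S
      using grow[OF that] by simp
    show "\<exists>S\<subseteq>?V. indep S contracted_edges \<and> card S = a - 1"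
    proof -
      obtain S where S: "S \<subseteq> V" "indep S E" "card S = a" using attained by blast
      have "\<exists>T\<subseteq>?V. indep T contracted_edges \<and> card S \<le> card T + 1"
      proof (cases "x \<in> S \<and> y \<in> S")
        case True
        then have "v \<notin> S" using indepD[OF S(2), of v x] v_edges path_verts by blast
        \<comment> \<open>The empty set stands for "no tolerated edge": it is an edge of neither graph.\<close>
        moreover have "indep (S - {y}) (contracted_edges - {{}})"
          using contraction_of_two_nbrs[of S "{}" "{}"] S(2) True calculation
          by (auto simp: indep_def contracted_edges_def)
        then have "indep (S - {y}) contracted_edges" by (auto simp: indep_def)
        ultimately show ?thesis using drop_one[of S] S by (intro exI[of _ "S - {y}"]) auto
      next
        case False
        have "\<not> (v \<in> S \<and> x \<in> S)" "\<not> (v \<in> S \<and> y \<in> S)"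
          using indepD[OF S(2), of v x] indepD[OF S(2), of v y] v_edges path_verts by auto
        then have "card S \<le> card (S - {v, x, y}) + 1" using drop_path[OF S(1) False] by blast
        moreover have "indep (S - {v, x, y}) contracted_edges"
          using S(2) by (auto simp: indep_def contracted_edge_iff)
        ultimately show ?thesis using S by (intro exI[of _ "S - {v, x, y}"]) auto
      qed
      then obtain T where T: "T \<subseteq> ?V" "indep T contracted_edges" "a \<le> card T + 1"
        using S(3) by blast
      then show ?thesis using grow[OF T(1,2)] by (intro exI[of _ T]) auto
    qed
    show "\<exists>A\<subseteq>?V. indep A (contracted_edges - {e'}) \<and> a - 1 < card A"
      if e': "e' \<in> contracted_edges" for e'
    proof -
      have "\<exists>B\<subseteq>?V. indep B (contracted_edges - {e'}) \<and> a \<le> card B"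
      proof -
        consider (old) "e' \<in> E" "e' \<subseteq> ?V" "x \<notin> e'" | (x) z where "e' = {x, z}" "e' \<in> E" "e' \<subseteq> ?V"
          | (y) z where "e' = {x, z}" "{y, z} \<in> E" "z \<noteq> v"
        proof (cases "e' \<in> E \<and> e' \<subseteq> ?V")
          case True
          then obtain p q where pq: "e' = {p, q}" using edge_cases by metis
          show thesis
          proof (cases "x \<in> e'")
            case False
            then show thesis using True that(1) by blast
          next
            case x: True
            have "e' = {x, if p = x then q else p}" using pq x by auto
            then show thesis using True that(2) by blast
          qed
        next
          case False
          then show thesis using e' that(3) unfolding contracted_edges_def by blast
        qed
        then show ?thesis
        proof cases
          case old
          obtain A where A: "A \<subseteq> V" "indep A (E - {e'})" "a < card A"
            using critical[OF old(1)] by blast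
          have only: "\<not> (p \<in> A \<and> q \<in> A)" if "{p, q} \<in> E" "{p, q} \<noteq> e'" for p q
            using A(2) that edge_in[OF that(1)] by (auto simp: indep_def)
          have "\<not> (v \<in> A \<and> x \<in> A)" "\<not> (v \<in> A \<and> y \<in> A)"
            using only[OF v_edges(1)] only[OF v_edges(2)] old by auto
          note v_excl = this
          show ?thesis
          proof (cases "x \<in> A \<and> y \<in> A")
            case True
            then have "v \<notin> A" using v_excl by blast
            have "indep (A - {y}) (contracted_edges - {e'})"
              by (rule contraction_of_two_nbrs[OF A(2) \<open>v \<notin> A\<close>]) (use True old in auto)
            then show ?thesis using A \<open>v \<notin> A\<close> drop_one[of A]
              by (intro exI[of _ "A - {y}"]) auto
          next
            case False
            show ?thesis
              using A drop_path[OF A(1) False v_excl] off_x[OF A(2)]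
              by (intro exI[of _ "A - {v, x, y}"]) auto
          qed
        next
          case (x z)
          obtain A where A: "A \<subseteq> V" "x \<in> A" "z \<in> A" "a < card A" "indep A (E - {{x, z}})"
            using witness x by metis
          have z: "z \<noteq> v" "z \<noteq> y" "{x, z} \<in> E" using x by auto
          have yA: "y \<in> A" using witness_contains_both[OF A(1,5,4,2) z(3,1)] .
          have vA: "v \<notin> A"
            using witness_edge[OF A(5) v_edges(1)] A(2) z by (auto simp: doubleton_eq_iff)
          have "indep (A - {y}) (contracted_edges - {e'})"
            by (rule contraction_of_two_nbrs[OF A(5) vA yA])
              (use x x_ne_y z in \<open>auto simp: doubleton_eq_iff\<close>)
          then show ?thesis using A vA drop_one[of A]
            by (intro exI[of _ "A - {y}"]) auto
        next
          case (y z)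
          have zx: "z \<noteq> x" using y nonadjacent by (auto simp: insert_commute)
          obtain A where A: "A \<subseteq> V" "y \<in> A" "z \<in> A" "a < card A" "indep A (E - {{y, z}})"
            using witness[OF y(2)] by blast
          have vA: "v \<notin> A"
            using witness_edge[OF A(5) v_edges(2)] A(2) y path_verts by (auto simp: doubleton_eq_iff)
          have "indep (A - {y}) (contracted_edges - {e'})"
            by (rule contraction_of_two_nbrs[OF A(5) vA A(2)])
              (use y zx path_verts x_ne_y in \<open>auto simp: doubleton_eq_iff contracted_edge_iff\<close>)
          then show ?thesis using A vA drop_one[of A]
            by (intro exI[of _ "A - {y}"]) auto
        qed
      qed
      then obtain B where "B \<subseteq> ?V" "indep B (contracted_edges - {e'})" "a \<le> card B" by blast
      then show ?thesis using a1 by (intro exI[of _ B]) auto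
    qed
  qed
qed

text \<open>
  Undoing the contraction adds one vertex to an independent set: \<open>y\<close> if the set contains \<open>x\<close>,
  and \<open>v\<close> if \<open>x\<close> is one of its neighbours. In both cases the neighbourhood also gains at most
  one vertex, namely \<open>v\<close> respectively \<open>y\<close>.
\<close>

lemma contraction_expanding:
  assumes exp: "expanding 1 V E"
  shows "expanding 1 (V - {v, y}) contracted_edges"
  unfolding expanding_def
proof (intro allI impI)
  fix I assume I: "I \<subseteq> V - {v, y}" "I \<noteq> {}" "indep I contracted_edges"
  interpret C: critical_graph "V - {v, y}" contracted_edges "a - 1" by (rule contraction_critical)
  have finI: "finite I" using I finite_subset_verts by blast
  have "v \<notin> I" "y \<notin> I" using I by auto
  then have card_v: "card (insert v I) = card I + 1" and card_y: "card (insert y I) = card I + 1"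
    using finI by auto
  let ?N = "nbrs contracted_edges I"
  have e: "card J + 1 \<le> card (nbrs E J)" if "J \<subseteq> V" "J \<noteq> {}" "indep J E" for J
    using exp that unfolding expanding_def by blast
  have IE: "{p, q} \<notin> E" if "p \<in> I" "q \<in> I" for p q
    using I that edge_in[of p q] by (auto simp: indep_def contracted_edge_iff)
  have no_y: "{y, q} \<notin> E" if "x \<in> I" "q \<in> I" for q
  proof
    assume yq: "{y, q} \<in> E"
    then have "q \<noteq> x" using nonadjacent by (auto simp: insert_commute)
    moreover have "{x, q} \<in> contracted_edges" using yq I that by (auto simp: contracted_edge_iff)
    ultimately show False using indepD[OF I(3) that] by blast
  qed
  have old: "z \<in> ?N \<or> z \<in> {v, y}" if "i \<in> I" "{i, z} \<in> E" for i z
    using that I by (auto simp: nbrs_iff contracted_edge_iff)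
  show "card I + 1 \<le> card ?N"
  proof (cases "x \<in> I")
    case True
    have "indep (insert y I) E"
      using IE no_y[OF True] by (auto simp: indep_def insert_commute)
    then have "card (insert y I) + 1 \<le> card (nbrs E (insert y I))"
      using I path_verts by (intro e) auto
    also have "nbrs E (insert y I) \<subseteq> insert v ?N"
    proof
      fix z assume "z \<in> nbrs E (insert y I)"
      then consider "{y, z} \<in> E" | i where "i \<in> I" "{i, z} \<in> E" by (auto simp: nbrs_iff)
      then show "z \<in> insert v ?N"
      proof cases
        case 1
        then show ?thesis using True by (auto simp: nbrs_iff contracted_edge_iff)
      next
        case 2
        then show ?thesis using old[OF 2] no_y[OF True, of i] by (auto simp: insert_commute)
      qed
    qed
    then have "card (nbrs E (insert y I)) \<le> card (insert v ?N)"
      by (rule card_mono[rotated]) (simp add: C.finite_nbrs)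
    also have "\<dots> \<le> card ?N + 1" by (simp add: card_insert_if C.finite_nbrs)
    finally show ?thesis using card_y by simp
  next
    case False
    show ?thesis
    proof (cases "x \<in> ?N")
      case xN: True
      have "indep (insert v I) E"
        using IE False v_edges(3) I by (auto simp: indep_def insert_commute)
      then have "card (insert v I) + 1 \<le> card (nbrs E (insert v I))"
        using I path_verts by (intro e) auto
      also have "nbrs E (insert v I) \<subseteq> insert y ?N"
      proof
        fix z assume "z \<in> nbrs E (insert v I)"
        then consider "{v, z} \<in> E" | i where "i \<in> I" "{i, z} \<in> E" by (auto simp: nbrs_iff)
        then show "z \<in> insert y ?N"
        proof cases
          case 1
          then show ?thesis using v_edges(3) xN by blast
        next
          case 2
          then show ?thesis
            using old[OF 2] v_edges(3)[of i] I False by (auto simp: insert_commute)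
        qed
      qed
      then have "card (nbrs E (insert v I)) \<le> card (insert y ?N)"
        by (rule card_mono[rotated]) (simp add: C.finite_nbrs)
      also have "\<dots> \<le> card ?N + 1" by (simp add: card_insert_if C.finite_nbrs)
      finally show ?thesis using card_v by simp
    next
      case xN: False
      have "card I + 1 \<le> card (nbrs E I)" using IE I by (intro e) (auto simp: indep_def)
      also have "nbrs E I \<subseteq> ?N"
      proof
        fix z assume "z \<in> nbrs E I"
        then obtain i where i: "i \<in> I" "{i, z} \<in> E" by (auto simp: nbrs_iff)
        have "z \<noteq> v" using i v_edges(3)[of i] False I by (auto simp: insert_commute)
        moreover have "z \<noteq> y"
        proof
          assume "z = y"
          then have "x \<in> ?N" using i I by (auto simp: nbrs_iff contracted_edge_iff insert_commute)
          then show False using xN by blast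
        qed
        ultimately show "z \<in> ?N" using old[OF i] by blast
      qed
      then have "card (nbrs E I) \<le> card ?N" by (rule card_mono[rotated]) (simp add: C.finite_nbrs)
      finally show ?thesis .
    qed
  qed
qed

text \<open>
  If \<open>y\<close> has degree two as well, undoing the contraction is an even subdivision of the edge
  \<open>{x, z}\<close> by the two vertices \<open>v\<close> and \<open>y\<close>.
\<close>

lemma edges_of_subdivided_contraction:
  assumes "nbrs E {y} = {v, z}" "z \<noteq> v"
  shows "{x, z} \<in> contracted_edges"
    and "E = contracted_edges - {{x, z}} \<union> {{x, v}, {v, y}, {y, z}}"
proof -
  have y: "{y, w} \<in> E \<longleftrightarrow> w = v \<or> w = z" for w using assms by (auto simp: nbrs_def)
  then show "{x, z} \<in> contracted_edges" using assms by (simp add: contracted_edge_iff)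
  have xz: "{x, z} \<notin> E" using no_other_common_nbr[of z] y assms by blast
  show "E = contracted_edges - {{x, z}} \<union> {{x, v}, {v, y}, {y, z}}" (is "_ = ?R")
  proof (rule set_eqI)
    fix e
    have new: "contracted_edges = {e \<in> E. e \<subseteq> V - {v, y}} \<union> {{x, z}}"
      using y assms unfolding contracted_edges_def by auto
    show "e \<in> E \<longleftrightarrow> e \<in> ?R"
    proof
      assume e: "e \<in> E"
      then obtain p q where pq: "e = {p, q}" "p \<in> V" "q \<in> V" by (rule edge_cases)
      consider "v \<in> e" | "y \<in> e" | "e \<subseteq> V - {v, y}" using pq by auto
      then show "e \<in> ?R"
      proof cases
        case 1
        then obtain w where "e = {v, w}" using pq by (metis insert_commute insert_iff singletonD)
        then show ?thesis using e v_edges(3)[of w] by (auto simp: insert_commute)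
      next
        case 2
        then obtain w where "e = {y, w}" using pq by (metis insert_commute insert_iff singletonD)
        then show ?thesis using e y[of w] by (auto simp: insert_commute)
      next
        case 3
        then show ?thesis using e xz new by blast
      qed
    next
      assume "e \<in> ?R"
      moreover have "{y, z} \<in> E" using y by simp
      ultimately show "e \<in> E" using new v_edges(1,2) by (auto simp: insert_commute)
    qed
  qed
qed

end

end

section \<open>Odd cycles and even subdivisions\<close>

definition cycle_edges :: "'a list \<Rightarrow> 'a set set" where
  "cycle_edges vs = {{vs ! i, vs ! (Suc i mod length vs)} | i. i < length vs}"

lemma odd_cycle_iff:
  "odd_cycle (V, E) \<longleftrightarrow>
    (\<exists>vs. distinct vs \<and> length vs \<ge> 3 \<and> odd (length vs) \<and> V = set vs \<and> E = cycle_edges vs)"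
  by (simp add: odd_cycle_def cycle_edges_def)

lemma cycle_edges_rotate: "cycle_edges (rotate k vs) = cycle_edges vs"
proof -
  have sub: "cycle_edges (rotate k ws) \<subseteq> cycle_edges ws" for k and ws :: "'a list"
  proof
    fix e assume "e \<in> cycle_edges (rotate k ws)"
    then obtain i where i: "i < length ws"
      "e = {rotate k ws ! i, rotate k ws ! (Suc i mod length ws)}"
      by (auto simp: cycle_edges_def)
    then have "0 < length ws" by auto
    then have "rotate k ws ! i = ws ! ((k + i) mod length ws)"
      "rotate k ws ! (Suc i mod length ws) = ws ! (Suc ((k + i) mod length ws) mod length ws)"
      using i by (simp_all add: nth_rotate mod_Suc_eq mod_add_right_eq)
    then show "e \<in> cycle_edges ws"
      using i \<open>0 < length ws\<close> unfolding cycle_edges_def by auto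
  qed
  show ?thesis
  proof (cases "vs = []")
    case False
    have "rotate (length vs - k mod length vs) (rotate k vs) = vs"
    proof -
      have "(length vs - k mod length vs + k) mod length vs = 0"
        using False by (metis add.commute le_add_diff_inverse2 length_greater_0_conv
            mod_add_left_eq mod_less_divisor mod_self less_imp_le)
      then show ?thesis by (simp add: rotate_rotate rotate_id)
    qed
    then show ?thesis using sub[of k vs] sub[of "length vs - k mod length vs" "rotate k vs"] by auto
  qed simp
qed

lemma cycle_edges_path:
  assumes "vs \<noteq> []"
  shows "cycle_edges vs = insert {last vs, hd vs} {{vs ! i, vs ! Suc i} | i. Suc i < length vs}"
proof (intro equalityI subsetI)
  fix e assume "e \<in> cycle_edges vs"
  then obtain i where i: "i < length vs" "e = {vs ! i, vs ! (Suc i mod length vs)}"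
    by (auto simp: cycle_edges_def)
  show "e \<in> insert {last vs, hd vs} {{vs ! i, vs ! Suc i} | i. Suc i < length vs}"
  proof (cases "Suc i < length vs")
    case True
    then show ?thesis using i by auto
  next
    case False
    then have "i = length vs - 1" "Suc i mod length vs = 0" using i by (auto simp: mod_Suc)
    then show ?thesis using i assms by (simp add: last_conv_nth hd_conv_nth)
  qed
next
  fix e assume "e \<in> insert {last vs, hd vs} {{vs ! i, vs ! Suc i} | i. Suc i < length vs}"
  then consider "e = {last vs, hd vs}" | i where "Suc i < length vs" "e = {vs ! i, vs ! Suc i}"
    by blast
  then show "e \<in> cycle_edges vs"
  proof cases
    case 1
    then have "e = {vs ! (length vs - 1), vs ! (Suc (length vs - 1) mod length vs)}"
      using assms by (simp add: last_conv_nth hd_conv_nth)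
    then show ?thesis using assms unfolding cycle_edges_def
      by (intro CollectI exI[of _ "length vs - 1"]) auto
  next
    case 2
    then have "e = {vs ! i, vs ! (Suc i mod length vs)}" by simp
    then show ?thesis using 2(1) unfolding cycle_edges_def
      by (intro CollectI exI[of _ i]) auto
  qed
qed

lemma cycle_edges_lengthen:
  assumes "distinct vs" "3 \<le> length vs"
  shows "cycle_edges (vs @ [p, q]) =
    cycle_edges vs - {{last vs, hd vs}} \<union> {{last vs, p}, {p, q}, {q, hd vs}}"
proof -
  let ?P = "{{vs ! i, vs ! Suc i} | i. Suc i < length vs}"
  have ne: "vs \<noteq> []" using assms by auto
  have "{last vs, hd vs} \<notin> ?P"
  proof
    assume "{last vs, hd vs} \<in> ?P"
    then obtain i where i: "Suc i < length vs" "{vs ! (length vs - 1), vs ! 0} = {vs ! i, vs ! Suc i}"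
      using ne by (auto simp: last_conv_nth hd_conv_nth)
    then have "{length vs - 1, 0} = {i, Suc i}"
      using assms ne by (auto simp: doubleton_eq_iff nth_eq_iff_index_eq)
    then show False using assms(2) by (auto simp: doubleton_eq_iff)
  qed
  moreover have "{{(vs @ [p, q]) ! i, (vs @ [p, q]) ! Suc i} | i. Suc i < length (vs @ [p, q])}
    = ?P \<union> {{last vs, p}, {p, q}}" (is "?L = ?R")
  proof (intro equalityI subsetI)
    fix e assume "e \<in> ?L"
    then obtain i where i: "Suc i < length vs + 2" "e = {(vs @ [p, q]) ! i, (vs @ [p, q]) ! Suc i}"
      by auto
    consider "Suc i < length vs" | "Suc i = length vs" | "i = length vs" using i by linarith
    then show "e \<in> ?R"
    proof cases
      case 1
      then show ?thesis using i by (auto simp: nth_append)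
    next
      case 2
      then have "i = length vs - 1" by simp
      then show ?thesis using i 2 ne by (simp add: nth_append last_conv_nth)
    next
      case 3
      then show ?thesis using i by (simp add: nth_append)
    qed
  next
    fix e assume "e \<in> ?R"
    then consider i where "Suc i < length vs" "e = {vs ! i, vs ! Suc i}"
      | "e = {last vs, p}" | "e = {p, q}" by blast
    then show "e \<in> ?L"
    proof cases
      case 1
      then show ?thesis by (intro CollectI exI[of _ i]) (simp add: nth_append)
    next
      case 2
      then show ?thesis using ne
        by (intro CollectI exI[of _ "length vs - 1"]) (simp add: nth_append last_conv_nth)
    next
      case 3
      then show ?thesis by (intro CollectI exI[of _ "length vs"]) (simp add: nth_append)
    qed
  qed
  ultimately show ?thesis
    using ne by (auto simp: cycle_edges_path)
qed

text \<open>
  After a rotation the subdivided edge joins the last vertex of the list to the first, so the two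
  new vertices can be appended, in the order given by the orientation of the edge.
\<close>

lemma odd_cycle_subdivide:
  assumes cyc: "odd_cycle (V, E)" and e: "{u, v} \<in> E"
    and new: "u' \<notin> V" "v' \<notin> V" "u' \<noteq> v'"
  shows "odd_cycle (V \<union> {u', v'}, (E - {{u, v}}) \<union> {{u, u'}, {u', v'}, {v', v}})"
proof -
  obtain vs where vs: "distinct vs" "3 \<le> length vs" "odd (length vs)" "V = set vs" "E = cycle_edges vs"
    using cyc unfolding odd_cycle_iff by blast
  obtain i where i: "i < length vs" "{u, v} = {vs ! i, vs ! (Suc i mod length vs)}"
    using e vs(5) by (auto simp: cycle_edges_def)
  define ws where "ws = rotate (Suc i) vs"
  have ws: "distinct ws" "3 \<le> length ws" "odd (length ws)" "V = set ws" "E = cycle_edges ws"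
    using vs by (simp_all add: ws_def cycle_edges_rotate del: rotate_Suc)
  have "ws \<noteq> []" using ws(2) by auto
  then have "last ws = vs ! i" "hd ws = vs ! (Suc i mod length vs)"
  proof -
    have "Suc i + (length vs - 1) = i + length vs" using i(1) by simp
    then have "(Suc i + (length vs - 1)) mod length vs = i" using i(1) by simp
    then show "last ws = vs ! i"
      using \<open>ws \<noteq> []\<close> i(1) by (simp add: ws_def last_conv_nth nth_rotate del: rotate_Suc add_Suc)
    show "hd ws = vs ! (Suc i mod length vs)"
      using i(1) hd_rotate_conv_nth[of vs "Suc i"] by (force simp: ws_def)
  qed
  then consider "u = last ws" "v = hd ws" | "u = hd ws" "v = last ws"
    using i(2) by (auto simp: doubleton_eq_iff)
  then show ?thesis
  proof cases
    case 1
    have "E - {{u, v}} \<union> {{u, u'}, {u', v'}, {v', v}} = cycle_edges (ws @ [u', v'])"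
      using cycle_edges_lengthen[OF ws(1,2)] 1 ws(5) by simp
    then show ?thesis
      unfolding odd_cycle_iff using ws new by (intro exI[of _ "ws @ [u', v']"]) auto
  next
    case 2
    have "E - {{u, v}} \<union> {{u, u'}, {u', v'}, {v', v}} = cycle_edges (ws @ [v', u'])"
      using cycle_edges_lengthen[OF ws(1,2)] 2 ws(5) by (auto simp: insert_commute)
    then show ?thesis
      unfolding odd_cycle_iff using ws new by (intro exI[of _ "ws @ [v', u']"]) auto
  qed
qed

lemma odd_cycle_edge_in:
  assumes "odd_cycle (V, E)" "{u, v} \<in> E" shows "u \<in> V" "v \<in> V"
proof -
  obtain vs where vs: "V = set vs" "E = cycle_edges vs"
    using assms unfolding odd_cycle_iff by blast
  then obtain i where i: "i < length vs" "{u, v} = {vs ! i, vs ! (Suc i mod length vs)}"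
    using assms(2) by (auto simp: cycle_edges_def)
  then have "Suc i mod length vs < length vs" by (metis gr_implies_not0 mod_less_divisor neq0_conv)
  then have "{u, v} \<subseteq> V" using i vs(1) by simp
  then show "u \<in> V" "v \<in> V" by auto
qed

lemma odd_cycle_triangle:
  assumes "v \<noteq> x" "v \<noteq> y" "x \<noteq> y"
  shows "odd_cycle ({v, x, y}, nsets {v, x, y} 2)"
proof -
  have "nsets {v, x, y} 2 = {{v, x}, {x, y}, {y, v}}"
    using assms by (auto simp: nsets_2_eq)
  moreover have "{{[v, x, y] ! i, [v, x, y] ! Suc i} | i. Suc i < length [v, x, y]} = {{v, x}, {x, y}}"
  proof -
    have "{i. Suc i < length [v, x, y]} = {0, 1}" by auto
    then show ?thesis by (simp only: setcompr_eq_image) auto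
  qed
  ultimately have "nsets {v, x, y} 2 = cycle_edges [v, x, y]"
    by (auto simp: cycle_edges_path)
  then show ?thesis unfolding odd_cycle_iff using assms by (intro exI[of _ "[v, x, y]"]) auto
qed

definition two_odd_cycles_or_K4 :: "'a graph \<Rightarrow> bool" where
  "two_odd_cycles_or_K4 G \<longleftrightarrow>
    (\<exists>C D. is_disjoint_union G C D \<and> odd_cycle C \<and> odd_cycle D) \<or> even_subdivision_of_K4 G"

lemma two_odd_cycles_or_K4_subdivide:
  assumes G: "two_odd_cycles_or_K4 (V, E)" and e: "{u, v} \<in> E"
    and new: "u' \<notin> V" "v' \<notin> V" "u' \<noteq> v'"
  shows "two_odd_cycles_or_K4 (V \<union> {u', v'}, (E - {{u, v}}) \<union> {{u, u'}, {u', v'}, {v', v}})"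
    (is "two_odd_cycles_or_K4 ?G")
proof -
  have cycles: "\<exists>C D. is_disjoint_union ?G C D \<and> odd_cycle C \<and> odd_cycle D"
    if "V = VC \<union> VD" "E = EC \<union> ED" "VC \<inter> VD = {}" "odd_cycle (VC, EC)" "odd_cycle (VD, ED)"
      "{u, v} \<in> EC" for VC EC VD ED
  proof -
    have "{u, v} \<notin> ED"
      using odd_cycle_edge_in[OF that(4,6)] odd_cycle_edge_in[OF that(5), of u v] that(3) by blast
    moreover have "odd_cycle (VC \<union> {u', v'}, (EC - {{u, v}}) \<union> {{u, u'}, {u', v'}, {v', v}})"
      using odd_cycle_subdivide[OF that(4,6)] new that(1) by blast
    ultimately show ?thesis
      using that new
      by (intro exI[of _ "(VC \<union> {u', v'}, (EC - {{u, v}}) \<union> {{u, u'}, {u', v'}, {v', v}})"]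
          exI[of _ "(VD, ED)"]) (auto simp: is_disjoint_union_def)
  qed
  show ?thesis
  proof (cases "even_subdivision_of_K4 (V, E)")
    case True
    then show ?thesis
      unfolding two_odd_cycles_or_K4_def even_subdivision_of_K4_def
      using even_subdivision.step[OF _ e new] by blast
  next
    case False
    then obtain VC EC VD ED where CD: "V = VC \<union> VD" "E = EC \<union> ED" "VC \<inter> VD = {}"
      "odd_cycle (VC, EC)" "odd_cycle (VD, ED)"
      using G by (auto simp: two_odd_cycles_or_K4_def is_disjoint_union_def)
    from e CD(2) consider "{u, v} \<in> EC" | "{u, v} \<in> ED" by blast
    then have "\<exists>C D. is_disjoint_union ?G C D \<and> odd_cycle C \<and> odd_cycle D"
    proof cases
      case 1
      then show ?thesis using cycles[OF CD(1,2,3,4,5)] by blast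
    next
      case 2
      then show ?thesis using cycles[of VD VC ED EC] CD by blast
    qed
    then show ?thesis by (simp add: two_odd_cycles_or_K4_def)
  qed
qed

section \<open>The shape of critical expanding graphs\<close>

context critical_graph
begin

lemma no_verts_no_edges: "V = {} \<Longrightarrow> E = {}"
  using simple by (simp add: nsets_empty_iff)

text \<open>
  A maximum independent set and its neighbourhood are disjoint.
\<close>

lemma expanding_lower_bound:
  assumes "expanding j V E" "V \<noteq> {}"
  shows "2 * a + j \<le> card V"
proof -
  obtain v where v: "v \<in> V" using assms by blast
  have "card {v} \<le> a" using bound[of "{v}"] v by (simp add: indep_def)
  then have "1 \<le> a" by simp
  obtain S where S: "S \<subseteq> V" "indep S E" "card S = a" using attained by blast
  then have "S \<noteq> {}" using \<open>1 \<le> a\<close> by auto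
  then have "a + j \<le> card (nbrs E S)" using assms S by (auto simp: expanding_def)
  moreover have "card (S \<union> nbrs E S) = a + card (nbrs E S)"
    using nbrs_indep_disjoint[OF S(2)] S finite_subset_verts finite_nbrs
    by (subst card_Un_disjoint) auto
  moreover have "card (S \<union> nbrs E S) \<le> card V"
    using S nbrs_subset finite_verts by (simp add: card_mono)
  ultimately show ?thesis by linarith
qed

lemma leaf_component:
  assumes "nbrs E {v} = {p}" "{p, c} \<in> E"
  shows "c = v"
proof (rule ccontr)
  assume "c \<noteq> v"
  obtain A where A: "A \<subseteq> V" "p \<in> A" "c \<in> A" "a < card A" "indep A (E - {{p, c}})"
    using witness[OF assms(2)] by blast
  have "{v, p} \<in> E" using assms by (auto simp: nbrs_def)
  then show False
    using witness_swap[OF A(1,5,4,2) _ assms(2), of v] \<open>c \<noteq> v\<close> assms(1) by auto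
qed

lemma triangle_component:
  assumes "nbrs E {v} = {x, y}" "{x, y} \<in> E" "{x, c} \<in> E"
  shows "c \<in> {v, y}"
proof (rule ccontr)
  assume c: "c \<notin> {v, y}"
  obtain A where A: "A \<subseteq> V" "x \<in> A" "c \<in> A" "a < card A" "indep A (E - {{x, c}})"
    using witness[OF assms(3)] by blast
  have "{v, x} \<in> E" using assms by (auto simp: nbrs_def)
  then have "y \<in> A"
    using witness_swap[OF A(1,5,4,2) _ assms(3), of v] c assms(1) by auto
  then show False
    using witness_edge[OF A(5) assms(2) A(2)] c by (auto simp: doubleton_eq_iff)
qed

end

text \<open>
  The parameter \<open>d\<close> is the defect, the number of vertices minus twice the independence number.
\<close>

definition defect_shape :: "nat \<Rightarrow> 'a graph \<Rightarrow> bool" where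
  "defect_shape d G \<longleftrightarrow>
    d = 0 \<and> G = ({}, {}) \<or> d = 1 \<and> odd_cycle G \<or> d = 2 \<and> two_odd_cycles_or_K4 G"

lemma defect_shape_subdivide:
  assumes "defect_shape d (V, E)" "{u, v} \<in> E" "u' \<notin> V" "v' \<notin> V" "u' \<noteq> v'"
  shows "defect_shape d (V \<union> {u', v'}, (E - {{u, v}}) \<union> {{u, u'}, {u', v'}, {v', v}})"
  using assms odd_cycle_subdivide[OF _ assms(2-5)] two_odd_cycles_or_K4_subdivide[OF _ assms(2-5)]
  unfolding defect_shape_def by (metis Pair_inject empty_iff)

text \<open>
  Induction on the number of vertices. If every independent set \<open>I \<noteq> {}\<close> has at least \<open>|I| + 2\<close>
  neighbours, the graph is empty or \<open>K\<^sub>4\<close>. Otherwise some vertex \<open>v\<close> has exactly two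
  neighbours. If these are adjacent, they form with \<open>v\<close> a triangle component, whose removal lowers the defect by one. If
  not, the path through \<open>v\<close> is contracted, which keeps the defect. The degree of the contracted
  vertex is the sum of the degrees of the two neighbours, each reduced by one, and by the degree
  bound it is at most three. So one neighbour has degree two, and the graph is an even
  subdivision of its contraction. The conclusion describes the whole graph, not just a spanning
  subgraph; this is what gives control over the edges at the contracted vertex.
\<close>

theorem critical_expanding_shape:
  assumes "critical_graph V E a" "expanding 1 V E" "card V = 2 * a + d" "d \<le> 2"
  shows "defect_shape d (V, E)"
  using assms
proof (induction "card V" arbitrary: V E a d rule: less_induct)
  case less
  interpret critical_graph V E a by (rule less.prems)
  note exp = less.prems(2) and n = less.prems(3)
  show ?case
  proof (cases "V = {}")
    case True
    then show ?thesis using n no_verts_no_edges by (simp add: defect_shape_def)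
  next
    case ne: False
    have d: "1 \<le> d" using expanding_lower_bound[OF exp ne] n by simp
    show ?thesis
    proof (cases "expanding 2 V E")
      case True
      then have "d = 2" using expanding_lower_bound[OF True ne] n less.prems(4) by simp
      moreover have "is_K4 (V, E)" using two_expanding_is_K4[OF True _ ne] n less.prems(4) by simp
      ultimately show ?thesis
        unfolding defect_shape_def two_odd_cycles_or_K4_def even_subdivision_of_K4_def
        using even_subdivision.refl by blast
    next
      case False
      then obtain v where v: "v \<in> V" "card (nbrs E {v}) = 2"
        using slack_vertex[OF exp] by (auto simp: numeral_2_eq_2)
      then obtain x y where vxy: "nbrs E {v} = {x, y}" "x \<noteq> y" by (auto simp: card_2_iff)
      have e: "{v, x} \<in> E" "{v, y} \<in> E" using vxy by (auto simp: nbrs_def)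
      then have V: "x \<in> V" "y \<in> V" "v \<noteq> x" "v \<noteq> y" using edge_in by blast+
      show ?thesis
      proof (cases "{x, y} \<in> E")
        case xy: True
        let ?X = "{v, x, y}"
        define F where "F = {e \<in> E. e \<subseteq> V - ?X}"
        have X: "?X \<subseteq> V" "?X \<noteq> {}" using v V by auto
        have clique: "\<And>p q. p \<in> ?X \<Longrightarrow> q \<in> ?X \<Longrightarrow> p \<noteq> q \<Longrightarrow> {p, q} \<in> E"
          using e xy by (auto simp: insert_commute)
        have closed: "q \<in> ?X" if p: "p \<in> ?X" and "{p, q} \<in> E" for p q
        proof -
          consider "p = v" | "p = x" | "p = y" using p by blast
          then show ?thesis
          proof cases
            case 1
            then show ?thesis using that vxy(1) by (auto simp: nbrs_def)
          next
            case 2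
            then show ?thesis using triangle_component[OF vxy(1) xy, of q] that by blast
          next
            case 3
            then show ?thesis
              using triangle_component[of v y x q] vxy(1) xy that by (auto simp: insert_commute)
          qed
        qed
        have removal: "1 \<le> a" "critical_graph (V - ?X) F (a - 1)"
          unfolding F_def
          by (rule clique_component_removal[OF X], fact clique, fact closed)+
        have exp': "expanding 1 (V - ?X) F"
          unfolding F_def
          by (rule clique_component_expanding[OF X _ _ exp], fact clique, fact closed)
        have "card ?X = 3" using V vxy by simp
        then have card: "card (V - ?X) = card V - 3" "3 \<le> card V"
          using X card_Diff_subset[of ?X V] card_mono[OF finite_verts X(1)] by auto
        have IH: "defect_shape (d - 1) (V - ?X, F)"
        proof (rule less.hyps)
          show "card (V - ?X) = 2 * (a - 1) + (d - 1)" using card n d removal(1) by simp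
        qed (use card less.prems removal(2) exp' in auto)
        have E: "E = F \<union> nsets ?X 2"
          unfolding F_def
          by (rule clique_component_edges[OF X], fact clique, fact closed)
        have tri: "odd_cycle (?X, nsets ?X 2)" using odd_cycle_triangle V vxy(2) by metis
        consider "d = 1" | "d = 2" using d less.prems(4) by linarith
        then show ?thesis
        proof cases
          case 1
          then have "V - ?X = {}" "F = {}" using IH by (auto simp: defect_shape_def)
          then have "V = ?X" "E = nsets ?X 2" using X(1) E by auto
          then show ?thesis using 1 tri by (simp add: defect_shape_def)
        next
          case 2
          then have "odd_cycle (V - ?X, F)" using IH by (simp add: defect_shape_def)
          moreover have "is_disjoint_union (V, E) (V - ?X, F) (?X, nsets ?X 2)"
            using E X by (auto simp: is_disjoint_union_def)
          ultimately show ?thesis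
            using 2 tri unfolding defect_shape_def two_odd_cycles_or_K4_def by blast
        qed
      next
        case xy: False
        have deg_ge: "2 \<le> card (nbrs E {w})" if "w \<in> V" for w
          using exp that by (auto simp: expanding_def indep_def dest!: spec[of _ "{w}"])
        \<comment> \<open>Stated for either order of the two neighbours, since either may be the one of degree two.\<close>
        have contract: "defect_shape d (V, E)"
          if vxy: "nbrs E {v} = {x, y}" "x \<noteq> y" "{x, y} \<notin> E" "card (nbrs E {y}) = 2" for x y
        proof -
          have in_V: "v \<in> V" "x \<in> V" "y \<in> V" "v \<noteq> x" "v \<noteq> y"
            using path_verts[OF vxy(1,2,3)] .
          have "v \<in> nbrs E {y}"
            using v_edges(2)[OF vxy(1,2,3)] by (simp add: nbrs_singleton_iff insert_commute)
          then obtain z where z: "nbrs E {y} = {v, z}" "z \<noteq> v"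
            using vxy(4) unfolding card_2_iff by (metis insert_commute insertE singletonD)
          let ?E = "contracted_edges v x y"
          have "card {v, y} = 2" "{v, y} \<subseteq> V" using in_V by auto
          then have card: "card (V - {v, y}) = card V - 2" "2 \<le> card V"
            using card_Diff_subset[of "{v, y}" V] card_mono[OF finite_verts, of "{v, y}"] by auto
          have IH: "defect_shape d (V - {v, y}, ?E)"
          proof (rule less.hyps)
            show "critical_graph (V - {v, y}) ?E (a - 1)"
              by (rule contraction_critical[OF vxy(1,2,3)])
            show "expanding 1 (V - {v, y}) ?E"
              by (rule contraction_expanding[OF vxy(1,2,3) exp])
            show "card (V - {v, y}) = 2 * (a - 1) + d"
              using card n contraction_critical(1)[OF vxy(1,2,3)] by simp
          qed (use card less.prems in auto)
          note E = edges_of_subdivided_contraction[OF vxy(1,2,3) z]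
          have "defect_shape d ((V - {v, y}) \<union> {v, y},
              ?E - {{x, z}} \<union> {{x, v}, {v, y}, {y, z}})"
            by (rule defect_shape_subdivide[OF IH E(1)]) (use in_V in auto)
          moreover have "(V - {v, y}) \<union> {v, y} = V" using in_V by auto
          ultimately show ?thesis using E(2) by simp
        qed
        let ?E = "contracted_edges v x y"
        interpret C: critical_graph "V - {v, y}" ?E "a - 1"
          by (rule contraction_critical[OF vxy xy])
        have "card (nbrs ?E {x}) \<le> d + 1"
        proof (rule C.degree_bound)
          show "expanding 1 (V - {v, y}) ?E" by (rule contraction_expanding[OF vxy xy exp])
          have "card {v, y} = 2" "{v, y} \<subseteq> V" using v V by auto
          then show "card (V - {v, y}) \<le> 2 * (a - 1) + d"
            using n card_Diff_subset[of "{v, y}" V] by simp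
          show "x \<in> V - {v, y}" using V vxy by auto
        qed
        moreover have "card (nbrs ?E {x}) = card (nbrs E {x} - {v}) + card (nbrs E {y} - {v})"
          unfolding contracted_x_nbrs[OF vxy xy]
        proof (rule card_Un_disjoint)
          show "(nbrs E {x} - {v}) \<inter> (nbrs E {y} - {v}) = {}"
            using no_other_common_nbr[OF vxy xy] by (auto simp: nbrs_singleton_iff)
        qed (use finite_nbrs in auto)
        moreover have "card (nbrs E {x} - {v}) = card (nbrs E {x}) - 1"
          "card (nbrs E {y} - {v}) = card (nbrs E {y}) - 1"
          using e by (simp_all add: nbrs_singleton_iff insert_commute)
        ultimately have "card (nbrs E {x}) = 2 \<or> card (nbrs E {y}) = 2"
          using deg_ge[OF V(1)] deg_ge[OF V(2)] less.prems(4) by linarith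
        then show ?thesis
          using contract[OF vxy xy] contract[of y x] vxy xy by (auto simp: insert_commute)
      qed
    qed
  qed
qed

section \<open>Splitting off a matching\<close>

text \<open>
  Where expansion is exact there is a vertex with a single neighbour, and the edge joining them is a
  component by \<open>leaf_component\<close>. Removing such components one by one keeps the defect.
\<close>

theorem critical_matching_decomposition:
  assumes "critical_graph V E a" "expanding 0 V E" "card V = 2 * a + d"
  shows "\<exists>M W F b. matching M \<and> is_disjoint_union (V, E) (W, F) M \<and>
    critical_graph W F b \<and> expanding 1 W F \<and> card W = 2 * b + d"
  using assms
proof (induction "card V" arbitrary: V E a rule: less_induct)
  case less
  interpret critical_graph V E a by (rule less.prems)
  show ?case
  proof (cases "expanding 1 V E")
    case True
    have "matching ({}, {})" "is_disjoint_union (V, E) (V, E) ({}, {})"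
      by (auto simp: matching_def simple_graph_def is_disjoint_union_def)
    then show ?thesis using less.prems True by blast
  next
    case False
    then obtain v where v: "v \<in> V" "card (nbrs E {v}) = 1"
      using slack_vertex[OF less.prems(2)] by auto
    then obtain p where p: "nbrs E {v} = {p}" by (auto simp: card_1_singleton_iff)
    then have vp: "{v, p} \<in> E" by (auto simp: nbrs_def)
    have V: "p \<in> V" "v \<noteq> p" using edge_in[OF vp] by auto
    let ?X = "{v, p}"
    define F where "F = {e \<in> E. e \<subseteq> V - ?X}"
    have X: "?X \<subseteq> V" "?X \<noteq> {}" using v V by auto
    have clique: "\<And>x y. x \<in> ?X \<Longrightarrow> y \<in> ?X \<Longrightarrow> x \<noteq> y \<Longrightarrow> {x, y} \<in> E"
      using vp by (auto simp: insert_commute)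
    have closed: "\<And>x y. x \<in> ?X \<Longrightarrow> {x, y} \<in> E \<Longrightarrow> y \<in> ?X"
      using p leaf_component[OF p] by (auto simp: nbrs_def)
    have removal: "1 \<le> a" "critical_graph (V - ?X) F (a - 1)"
      unfolding F_def by (rule clique_component_removal[OF X], fact clique, fact closed)+
    have exp: "expanding 0 (V - ?X) F"
      unfolding F_def
      by (rule clique_component_expanding[OF X _ _ less.prems(2)], fact clique, fact closed)
    have E: "E = F \<union> {?X}"
      using clique_component_edges[OF X clique closed] V unfolding F_def by simp
    have "card ?X = 2" using V by simp
    then have card: "card (V - ?X) = card V - 2" "2 \<le> card V"
      using X card_Diff_subset[of ?X V] card_mono[OF finite_verts X(1)] by auto
    have "\<exists>M W F' b. matching M \<and> is_disjoint_union (V - ?X, F) (W, F') M \<and>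
      critical_graph W F' b \<and> expanding 1 W F' \<and> card W = 2 * b + d"
    proof (rule less.hyps)
      show "card (V - ?X) = 2 * (a - 1) + d" using card less.prems(3) removal(1) by simp
    qed (use card removal exp in auto)
    then obtain VM EM W F' b where IH: "matching (VM, EM)"
      "is_disjoint_union (V - ?X, F) (W, F') (VM, EM)"
      "critical_graph W F' b" "expanding 1 W F'" "card W = 2 * b + d"
      by (metis surj_pair)
    have union: "V - ?X = W \<union> VM" "F = F' \<union> EM" "W \<inter> VM = {}"
      using IH(2) by (auto simp: is_disjoint_union_def)
    have "matching (insert v (insert p VM), insert ?X EM)"
    proof -
      have M: "finite VM" "EM \<subseteq> nsets VM 2" "VM = \<Union>EM"
        "\<And>e f. e \<in> EM \<Longrightarrow> f \<in> EM \<Longrightarrow> e \<noteq> f \<Longrightarrow> e \<inter> f = {}"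
        using IH(1) by (auto simp: matching_def simple_graph_def)
      have "e \<inter> ?X = {}" if "e \<in> EM" for e
      proof -
        have "e \<subseteq> VM" using that M(3) by blast
        then show ?thesis using union(1) by blast
      qed
      moreover have "insert ?X EM \<subseteq> nsets (insert v (insert p VM)) 2"
        using M(2) nsets_mono[of VM "insert v (insert p VM)" 2] V by auto
      ultimately show ?thesis
        using M V by (auto simp: matching_def simple_graph_def)
    qed
    moreover have "is_disjoint_union (V, E) (W, F') (insert v (insert p VM), insert ?X EM)"
      using union E X by (auto simp: is_disjoint_union_def)
    ultimately show ?thesis using IH(3-5) by blast
  qed
qed

section \<open>From stability to expansion\<close>

text \<open>
  Delete edges as long as the independence number stays the same. Any stability of the original
  graph survives, because independent sets stay independent.
\<close>

lemma critical_spanning_subgraph: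
  assumes "finite V" "E \<subseteq> nsets V 2"
    and bound: "\<And>S. S \<subseteq> V \<Longrightarrow> indep S E \<Longrightarrow> card S \<le> a"
    and attained: "\<exists>S\<subseteq>V. indep S E \<and> card S = a"
  obtains F where "F \<subseteq> E" "critical_graph V F a"
proof -
  define P where "P F \<longleftrightarrow> F \<subseteq> E \<and> (\<forall>S\<subseteq>V. indep S F \<longrightarrow> card S \<le> a)" for F
  have "P E" using bound by (simp add: P_def)
  then obtain F where F: "P F" and min: "\<And>F'. P F' \<Longrightarrow> card F \<le> card F'"
    by (metis ex_has_least_nat)
  have FE: "F \<subseteq> E" and Fb: "\<And>S. S \<subseteq> V \<Longrightarrow> indep S F \<Longrightarrow> card S \<le> a"
    using F by (auto simp: P_def)
  have "finite E" using assms(1,2) finite_imp_finite_nsets finite_subset by blast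
  then have finF: "finite F" using FE finite_subset by blast
  have "critical_graph V F a"
  proof
    show "\<exists>S\<subseteq>V. indep S F \<and> card S = a" using attained FE indep_fewer_edges by blast
    show "\<exists>A\<subseteq>V. indep A (F - {e}) \<and> a < card A" if "e \<in> F" for e
    proof (rule ccontr)
      assume "\<not> ?thesis"
      then have "P (F - {e})" using FE by (auto simp: P_def not_less)
      then have "card F \<le> card (F - {e})" by (rule min)
      then show False using card_Diff1_less[OF finF that] by simp
    qed
  qed (use assms FE Fb in auto)
  then show thesis using that FE by blast
qed

context critical_graph
begin

text \<open>
  Induction on \<open>I\<close>. A maximum independent set \<open>S\<close> that avoids some \<open>v \<in> I\<close> splits \<open>I\<close>. The proper
  part \<open>I \<inter> S\<close> expands by induction, with all its neighbours outside \<open>S\<close>. The part \<open>I - S\<close> has at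
  least \<open>|I - S|\<close> neighbours inside \<open>S\<close>, since otherwise swapping them for \<open>I - S\<close> would enlarge
  \<open>S\<close>. As \<open>S\<close> also avoids \<open>W\<close>, neither count uses vertices of \<open>W\<close>.
\<close>

lemma expansion_by_swapping:
  assumes "I \<subseteq> V" "indep I E"
    and "\<And>v. v \<in> I \<Longrightarrow> \<exists>S\<subseteq>V. indep S E \<and> a \<le> card S \<and> v \<notin> S \<and> S \<inter> W = {}"
  shows "card I \<le> card (nbrs E I - W)"
proof -
  have "finite I" using assms(1) finite_subset_verts by blast
  then show ?thesis using assms
  proof (induction I rule: finite_psubset_induct)
    case (psubset I)
    show ?case
    proof (cases "I = {}")
      case False
      then obtain v where v: "v \<in> I" by blast
      obtain S where S: "S \<subseteq> V" "indep S E" "a \<le> card S" "v \<notin> S" "S \<inter> W = {}"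
        using psubset.prems(3)[OF v] by blast
      have finS: "finite S" using S finite_subset_verts by blast
      have Ii: "indep I E" and IV: "I \<subseteq> V" using psubset.prems by auto
      let ?N = "nbrs E (I - S)"
      have inner: "card (I \<inter> S) \<le> card (nbrs E (I \<inter> S) - W)"
      proof (rule psubset.IH)
        show "I \<inter> S \<subset> I" using v S by blast
        show "I \<inter> S \<subseteq> V" using IV by blast
        show "indep (I \<inter> S) E" by (rule indep_subset[OF Ii]) blast
      qed (use psubset.prems(3) in blast)
      have "indep ((S - ?N) \<union> (I - S)) E"
        unfolding indep_def
      proof (intro ballI impI notI)
        fix x y assume xy: "x \<in> (S - ?N) \<union> (I - S)" "y \<in> (S - ?N) \<union> (I - S)" "x \<noteq> y" "{x, y} \<in> E"
        have "\<not> (x \<in> I \<and> y \<in> I)" "\<not> (x \<in> S \<and> y \<in> S)"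
          using indepD[OF Ii, of x y] indepD[OF S(2), of x y] xy(3,4) by auto
        then consider "x \<in> I - S" "y \<in> S - ?N" | "y \<in> I - S" "x \<in> S - ?N" using xy(1,2) by blast
        then show False using xy(4) by cases (auto simp: nbrs_iff insert_commute)
      qed
      then have "card ((S - ?N) \<union> (I - S)) \<le> a" by (rule bound[rotated]) (use S IV in blast)
      moreover have "card ((S - ?N) \<union> (I - S)) = card (S - ?N) + card (I - S)"
        using finS psubset.hyps by (intro card_Un_disjoint) auto
      moreover have "card S = card (S \<inter> ?N) + card (S - ?N)" by (rule card_Int_Diff[OF finS])
      ultimately have outer: "card (I - S) \<le> card (S \<inter> ?N)" using S(3) by linarith
      have "card ((nbrs E (I \<inter> S) - W) \<union> (S \<inter> ?N)) = card (nbrs E (I \<inter> S) - W) + card (S \<inter> ?N)"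
      proof (rule card_Un_disjoint)
        have "nbrs E (I \<inter> S) \<inter> S = {}"
          using nbrs_indep_disjoint[OF S(2)] by (auto simp: nbrs_def)
        then show "(nbrs E (I \<inter> S) - W) \<inter> (S \<inter> ?N) = {}" by blast
      qed (use finite_nbrs finS in auto)
      moreover have "card ((nbrs E (I \<inter> S) - W) \<union> (S \<inter> ?N)) \<le> card (nbrs E I - W)"
        using S(5) finite_nbrs[of I] by (intro card_mono) (auto simp: nbrs_def)
      moreover have "card I = card (I \<inter> S) + card (I - S)"
        by (rule card_Int_Diff[OF psubset.hyps])
      ultimately show ?thesis using inner outer by linarith
    qed simp
  qed
qed

lemma expanding_of_avoiding_one:
  assumes "\<And>v. v \<in> V \<Longrightarrow> \<exists>S\<subseteq>V - {v}. indep S E \<and> a \<le> card S"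
  shows "expanding 0 V E"
  unfolding expanding_def
proof (intro allI impI)
  fix I assume I: "I \<subseteq> V" "indep I E"
  have "card I \<le> card (nbrs E I - {})"
  proof (rule expansion_by_swapping[OF I])
    fix v assume "v \<in> I"
    then show "\<exists>S\<subseteq>V. indep S E \<and> a \<le> card S \<and> v \<notin> S \<and> S \<inter> {} = {}"
      using assms[of v] I(1) by blast
  qed
  then show "card I + 0 \<le> card (nbrs E I)" by simp
qed

text \<open>
  The second avoided vertex is spent on a neighbour \<open>w\<close> of \<open>I\<close>: even without \<open>w\<close> the neighbourhood
  has size at least \<open>|I|\<close>.
\<close>

lemma expanding_of_avoiding_two:
  assumes "2 \<le> card V"
    and avoid: "\<And>v w. v \<in> V \<Longrightarrow> w \<in> V \<Longrightarrow> v \<noteq> w \<Longrightarrow> \<exists>S\<subseteq>V - {v, w}. indep S E \<and> a \<le> card S"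
  shows "expanding 1 V E"
proof -
  have exp: "expanding 0 V E"
  proof (rule expanding_of_avoiding_one)
    fix v assume v: "v \<in> V"
    have "V \<noteq> {v}" using assms(1) by auto
    then obtain w where "w \<in> V" "w \<noteq> v" using v by blast
    then show "\<exists>S\<subseteq>V - {v}. indep S E \<and> a \<le> card S" using avoid[OF v, of w] by blast
  qed
  show ?thesis
    unfolding expanding_def
  proof (intro allI impI)
    fix I assume I: "I \<subseteq> V" "I \<noteq> {}" "indep I E"
    have "0 < card I" using I finite_subset_verts[OF I(1)] by (simp add: card_gt_0_iff)
    then have "nbrs E I \<noteq> {}"
      using exp[unfolded expanding_def, rule_format, OF I(1,2,3)] by auto
    then obtain w where w: "w \<in> nbrs E I" by blast
    have "w \<in> V" "w \<notin> I" using w nbrs_subset nbrs_indep_disjoint[OF I(3)] by auto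
    have "card I \<le> card (nbrs E I - {w})"
    proof (rule expansion_by_swapping[OF I(1,3)])
      fix v assume "v \<in> I"
      then have "v \<in> V" "v \<noteq> w" using I \<open>w \<notin> I\<close> by auto
      then show "\<exists>S\<subseteq>V. indep S E \<and> a \<le> card S \<and> v \<notin> S \<and> S \<inter> {w} = {}"
        using avoid[of v w] \<open>w \<in> V\<close> by blast
    qed
    moreover have "Suc (card (nbrs E I - {w})) = card (nbrs E I)"
      by (rule card_Suc_Diff1[OF finite_nbrs w])
    ultimately show "card I + 1 \<le> card (nbrs E I)" by simp
  qed
qed

section \<open>Chords of a spanning odd cycle\<close>

text \<open>
  A critical expanding graph of defect one is an odd cycle, on which there are two vertices \<open>w\<close> and
  \<open>z\<close>, adjacent on the cycle, such that the only maximum independent set avoiding both contains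
  \<open>u\<close> and \<open>v\<close>. To see this without coordinates, take the witnesses of the two edges at \<open>u\<close>: they
  cover all vertices and meet only in \<open>u\<close>, so one of them, belonging to an edge \<open>{u, w}\<close>, contains
  \<open>v\<close>. The vertex \<open>z\<close> is the other neighbour of \<open>w\<close>, and the forced set is that witness without
  \<open>w\<close>. Two-fold stability then excludes every chord of the cycle.
\<close>

lemma nonadjacent_pair_forced:
  assumes exp: "expanding 1 V E" and n: "card V = 2 * a + 1"
    and uv: "u \<in> V" "v \<in> V" "u \<noteq> v" "{u, v} \<notin> E"
  shows "\<exists>w\<in>V. \<exists>z\<in>V. w \<noteq> z \<and>
    (\<forall>S\<subseteq>V - {w, z}. indep S E \<longrightarrow> a \<le> card S \<longrightarrow> u \<in> S \<and> v \<in> S)"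
proof -
  have deg_ge: "2 \<le> card (nbrs E {x})" if "x \<in> V" for x
    using exp that by (auto simp: expanding_def indep_def dest!: spec[of _ "{x}"])
  have deg: "card (nbrs E {x}) = 2" if "x \<in> V" for x
    using degree_bound[OF exp, of 1 x] deg_ge[OF that] n that by simp
  obtain w w' where ww: "nbrs E {u} = {w, w'}" "w \<noteq> w'"
    using deg[OF uv(1)] by (auto simp: card_2_iff)
  have e: "{u, w} \<in> E" "{u, w'} \<in> E" using ww by (auto simp: nbrs_def)
  have key: ?thesis
    if e: "{u, w} \<in> E" "{u, w'} \<in> E" "w \<noteq> w'"
      and A: "A \<subseteq> V" "u \<in> A" "w \<in> A" "a < card A" "indep A (E - {{u, w}})"
      and B: "B \<subseteq> V" "u \<in> B" "w' \<in> B" "a < card B" "indep B (E - {{u, w'}})"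
      and AB: "A \<union> B = V" "card A = a + 1" and vA: "v \<in> A" for w w' A B
  proof -
    have finA: "finite A" using A finite_subset_verts by blast
    have wV: "w \<in> V" "w \<noteq> u" using edge_in[OF e(1)] by auto
    have "u \<in> nbrs E {w}" using e by (simp add: nbrs_singleton_iff insert_commute)
    then obtain z where z: "nbrs E {w} = {u, z}" "z \<noteq> u"
      using deg[OF wV(1)] unfolding card_2_iff by (metis insert_commute insertE singletonD)
    have wz: "{w, z} \<in> E" using z by (auto simp: nbrs_def)
    have zV: "z \<in> V" "w \<noteq> z" using edge_in[OF wz] by auto
    have zA: "z \<notin> A"
      using witness_edge[OF A(5) wz A(3)] z by (auto simp: doubleton_eq_iff)
    have "u \<in> S \<and> v \<in> S" if S: "S \<subseteq> V - {w, z}" "indep S E" "a \<le> card S" for S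
    proof -
      define I where "I = S - A"
      have finS: "finite S" using S finite_subset_verts by blast
      have Aw: "card (A - {w}) = a" using AB(2) A(3) finA by simp
      have cS: "card S = card (S \<inter> A) + card I" unfolding I_def by (rule card_Int_Diff[OF finS])
      \<comment> \<open>The outside of \<open>A\<close> is independent, so the neighbours of \<open>I\<close> lie in \<open>A\<close>, outside \<open>S\<close> and
        different from \<open>w\<close>; by expansion \<open>S\<close> would be too small.\<close>
      have "I = {}"
      proof (rule ccontr)
        assume "I \<noteq> {}"
        have "I \<subseteq> V" using S by (auto simp: I_def)
        moreover have "indep I E" by (rule indep_subset[OF S(2)]) (auto simp: I_def)
        ultimately have "card I + 1 \<le> card (nbrs E I)"
          using exp \<open>I \<noteq> {}\<close> by (auto simp: expanding_def)
        moreover have "nbrs E I \<subseteq> A - {w} - S"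
        proof
          fix y assume "y \<in> nbrs E I"
          then obtain i where i: "i \<in> S" "i \<notin> A" "{i, y} \<in> E" by (auto simp: nbrs_iff I_def)
          have "y \<in> V" "i \<in> V" "i \<noteq> y" using edge_in[OF i(3)] by auto
          have "y \<notin> S" using indepD[OF S(2) i(1), of y] i(3) \<open>i \<noteq> y\<close> by blast
          moreover have "y \<noteq> w"
          proof
            assume "y = w"
            then have "i \<in> nbrs E {w}" using i by (simp add: nbrs_singleton_iff insert_commute)
            then show False using z i S(1) A(2) by auto
          qed
          moreover have "y \<in> A"
          proof (rule ccontr)
            assume "y \<notin> A"
            then have "y \<in> B" "i \<in> B" using AB(1) i \<open>y \<in> V\<close> \<open>i \<in> V\<close> by auto
            then have "{i, y} = {u, w'}" using witness_edge[OF B(5) i(3)] by blast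
            then show False using i A(2) \<open>y \<notin> A\<close> by (auto simp: doubleton_eq_iff)
          qed
          ultimately show "y \<in> A - {w} - S" by blast
        qed
        then have "card (nbrs E I \<union> (S \<inter> A)) \<le> card (A - {w})"
          using S(1) finA by (intro card_mono) auto
        moreover have "card (nbrs E I \<union> (S \<inter> A)) = card (nbrs E I) + card (S \<inter> A)"
          using \<open>nbrs E I \<subseteq> A - {w} - S\<close> finite_nbrs finS by (intro card_Un_disjoint) auto
        ultimately show False using Aw cS S(3) by linarith
      qed
      then have "S \<subseteq> A - {w}" using S by (auto simp: I_def)
      then have "S = A - {w}" using Aw S(3) finA by (intro card_seteq) auto
      moreover have "v \<noteq> w" using uv(4) e by blast
      ultimately show ?thesis using A(2) vA wV by blast
    qed
    then show ?thesis using wV zV by blast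
  qed
  obtain A where A: "A \<subseteq> V" "u \<in> A" "w \<in> A" "a < card A" "indep A (E - {{u, w}})"
    using witness[OF e(1)] by blast
  obtain B where B: "B \<subseteq> V" "u \<in> B" "w' \<in> B" "a < card B" "indep B (E - {{u, w'}})"
    using witness[OF e(2)] by blast
  have "A \<inter> B = {u}" using witnesses_meet_once[OF exp _ e ww(2) A B] n by simp
  then have c: "card A + card B = card (A \<union> B) + 1"
    using card_Un_Int[of A B] A B finite_subset_verts by auto
  have sub: "A \<union> B \<subseteq> V" using A B by blast
  then have "card (A \<union> B) \<le> card V" using finite_verts card_mono by blast
  then have "card (A \<union> B) = card V" "card A = a + 1" "card B = a + 1"
    using c A(4) B(4) n by linarith+
  then have AB: "A \<union> B = V" using sub finite_verts by (simp add: card_subset_eq)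
  have "v \<in> A \<or> v \<in> B" using AB uv by blast
  then show ?thesis
    using key[OF e ww(2) A B AB \<open>card A = a + 1\<close>]
      key[OF e(2,1) ww(2)[symmetric] B A _ \<open>card B = a + 1\<close>] AB by (auto simp: Un_commute)
qed

end

section \<open>The theorem\<close>

lemma independence_number_attained:
  assumes "finite (verts G)"
  shows "\<exists>S. independent_set G S \<and> card S = independence_number G"
    and "independent_set G S \<Longrightarrow> card S \<le> independence_number G"
proof -
  have "{S. independent_set G S} \<subseteq> Pow (verts G)" by (auto simp: independent_set_def)
  then have fin: "finite (card ` {S. independent_set G S})"
    using assms finite_subset by blast
  have "independent_set G {}" by (simp add: independent_set_def indep_def)
  then have "independence_number G \<in> card ` {S. independent_set G S}"
    unfolding independence_number_def using fin by (intro Max_in) auto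
  then show "\<exists>S. independent_set G S \<and> card S = independence_number G" by auto
  show "card S \<le> independence_number G" if "independent_set G S"
    unfolding independence_number_def using fin that by (intro Max_ge) auto
qed

lemma stable_avoids:
  assumes "finite V" "stable k (V, E)" "X \<subseteq> V" "card X = k"
  shows "\<exists>S\<subseteq>V - X. indep S E \<and> independence_number (V, E) \<le> card S"
proof -
  have "finite (verts (delete_verts (V, E) X))" using assms by (simp add: delete_verts_def)
  then obtain S where S: "independent_set (delete_verts (V, E) X) S"
    "card S = independence_number (delete_verts (V, E) X)"
    using independence_number_attained(1) by blast
  then have "S \<subseteq> V - X" "indep S E"
    unfolding independent_set_def delete_verts_def indep_def by auto
  moreover have "independence_number (V, E) \<le> card S"
    using assms(2-4) S(2) by (simp add: stable_def)
  ultimately show ?thesis by blast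
qed

theorem theorem1p1:
  fixes G :: "'a graph" and k n :: nat
  assumes "k \<in> {1, 2}"
    and "simple_graph G"
    and "card (verts G) = n"
    and "tight_stable k G"
  shows "(k = 1 \<and> even n \<longrightarrow> has_perfect_matching G) \<and>
    (k = 1 \<and> odd n \<longrightarrow>
      (\<exists>H C M. spanning_subgraph H G \<and> is_disjoint_union H C M \<and> odd_cycle C \<and> matching M)) \<and>
    (k = 2 \<and> odd n \<longrightarrow> odd_cycle G) \<and>
    (k = 2 \<and> even n \<longrightarrow>
      (\<exists>H. spanning_subgraph H G \<and>
        ((\<exists>C D. is_disjoint_union H C D \<and> odd_cycle C \<and> odd_cycle D) \<or>
         even_subdivision_of_K4 H)))"
proof -
  obtain V E where G: "G = (V, E)" by fastforce
  define a where "a = independence_number G"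
  have V: "finite V" "E \<subseteq> nsets V 2" "card V = n"
    using assms by (auto simp: G simple_graph_def)
  have "card S \<le> a" if "S \<subseteq> V" "indep S E" for S
    using independence_number_attained(2)[of G S] V(1) that
    by (simp add: G a_def independent_set_def)
  moreover have "\<exists>S\<subseteq>V. indep S E \<and> card S = a"
    using independence_number_attained(1)[of G] V(1)
    by (auto simp: G a_def independent_set_def)
  ultimately obtain F where F: "F \<subseteq> E" "critical_graph V F a"
    using critical_spanning_subgraph[OF V(1,2)] by blast
  interpret critical_graph V F a by (rule F(2))
  have span: "spanning_subgraph (V, F) G"
    using V F simple by (simp add: spanning_subgraph_def simple_graph_def G)
  have tight: "stable k (V, E)" "int a = (int n - int k + 1) div 2"
    using assms V by (auto simp: tight_stable_def G a_def)
  have avoid: "\<exists>S\<subseteq>V - X. indep S E \<and> indep S F \<and> a \<le> card S" if "X \<subseteq> V" "card X = k" for X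
    using stable_avoids[OF V(1) tight(1) that] indep_fewer_edges[OF _ F(1)]
    by (auto simp: a_def G)
  show ?thesis
  proof (cases "k = 1")
    case k: True
    define d where "d = n mod 2"
    have "int n = 2 * int a + int d" using tight(2) unfolding k d_def by (simp add: zmod_int)
    then have d: "n = 2 * a + d" "d \<le> 2" by (auto simp: d_def)
    have "expanding 0 V F"
    proof (rule expanding_of_avoiding_one)
      fix v assume "v \<in> V"
      then show "\<exists>S\<subseteq>V - {v}. indep S F \<and> a \<le> card S" using avoid[of "{v}"] k by auto
    qed
    then obtain M W F' b where M: "matching M" "is_disjoint_union (V, F) (W, F') M"
      "critical_graph W F' b" "expanding 1 W F'" "card W = 2 * b + d"
      using critical_matching_decomposition[OF F(2), of d] d V(3) by blast
    have shape: "defect_shape d (W, F')"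
      by (rule critical_expanding_shape[OF M(3,4,5) d(2)])
    show ?thesis
    proof (cases "even n")
      case True
      then have "W = {}" "F' = {}" using shape by (auto simp: d_def defect_shape_def)
      then have "M = (V, F)" using M(2) by (cases M) (simp add: is_disjoint_union_def)
      then show ?thesis using True k span M(1) by (auto simp: has_perfect_matching_def)
    next
      case False
      then have "odd_cycle (W, F')"
        using shape by (auto simp: d_def defect_shape_def odd_iff_mod_2_eq_one)
      then have "\<exists>H C M. spanning_subgraph H G \<and> is_disjoint_union H C M \<and> odd_cycle C \<and> matching M"
        using span M(1,2) by blast
      then show ?thesis using False k by simp
    qed
  next
    case False
    then have k: "k = 2" using assms(1) by simp
    obtain d where d: "n = 2 * a + d" "d = 1 \<and> odd n \<or> d = 2 \<and> even n"
    proof -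
      have "int a = (int n - 1) div 2" using tight(2) k by simp
      then have "n = 2 * a + 1 \<and> odd n \<or> n = 2 * a + 2 \<and> even n" by presburger
      then show thesis using that[of 1] that[of 2] by blast
    qed
    have n2: "2 \<le> card V"
    proof (rule ccontr)
      assume "\<not> 2 \<le> card V"
      then have "n = 1" "a = 0" using d V(3) by linarith+
      then obtain v where "V = {v}" using V(3) by (auto simp: card_1_singleton_iff)
      then show False using bound[of "{v}"] \<open>a = 0\<close> by (simp add: indep_def)
    qed
    have exp: "expanding 1 V F"
    proof (rule expanding_of_avoiding_two[OF n2])
      fix v w assume "v \<in> V" "w \<in> V" "v \<noteq> w"
      then show "\<exists>S\<subseteq>V - {v, w}. indep S F \<and> a \<le> card S" using avoid[of "{v, w}"] k by auto
    qed
    have shape: "defect_shape d (V, F)"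
      using critical_expanding_shape[OF F(2) exp, of d] d V(3) by force
    show ?thesis
    proof (cases "odd n")
      case True
      then have cyc: "odd_cycle (V, F)" using shape d(2) by (simp add: defect_shape_def)
      have n_odd: "card V = 2 * a + 1" using True d V(3) by auto
      have "E \<subseteq> F"
      proof
        fix e assume e: "e \<in> E"
        then obtain u v where uv: "e = {u, v}" "u \<in> V" "v \<in> V" "u \<noteq> v"
          using V(2) by (meson nsets2_E subsetD)
        show "e \<in> F"
        proof (rule ccontr)
          assume "e \<notin> F"
          then obtain w z where wz: "w \<in> V" "z \<in> V" "w \<noteq> z"
            "\<And>S. S \<subseteq> V - {w, z} \<Longrightarrow> indep S F \<Longrightarrow> a \<le> card S \<Longrightarrow> u \<in> S \<and> v \<in> S"
            using nonadjacent_pair_forced[OF exp n_odd uv(2,3,4)] uv(1) by blast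
          obtain S where S: "S \<subseteq> V - {w, z}" "indep S E" "indep S F" "a \<le> card S"
            using avoid[of "{w, z}"] wz k by auto
          then show False using wz(4)[OF S(1,3,4)] indepD[OF S(2), of u v] e uv by blast
        qed
      qed
      then have "G = (V, F)" using F(1) by (simp add: G)
      then show ?thesis using True k cyc by simp
    next
      case False
      then have "two_odd_cycles_or_K4 (V, F)" using shape d(2) by (simp add: defect_shape_def)
      then have "\<exists>H. spanning_subgraph H G \<and>
          ((\<exists>C D. is_disjoint_union H C D \<and> odd_cycle C \<and> odd_cycle D) \<or> even_subdivision_of_K4 H)"
        using span unfolding two_odd_cycles_or_K4_def by blast
      then show ?thesis using False k by simp
    qed
  qed
qed

end
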